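(* Let $\mathbb{X},\mathbb{Y},\mathbb{A}$ be Borel subsets of Polish spaces, $P(dx'|x,a)$ a stochastic kernel on $\mathbb{X}$ given $\mathbb{X}\times\mathbb{A}$, and $Q(dy|a,x)$ a stochastic kernel on $\mathbb{Y}$ given $\mathbb{A}\times\mathbb{X}$. Suppose that either (i) the stochastic kernel $R'(dy|z,a)$ on $\mathbb{Y}$ given $\mathbb{P}(\mathbb{X})\times\mathbb{A}$ is setwise continuous and Assumption (H) holds, or (ii) the stochastic kernels $P$ and $Q$ are weakly continuous and there exists a weakly continuous stochastic kernel $H(dx|z,a,y)$ on $\mathbb{X}$ given $\mathbb{P}(\mathbb{X})\times\mathbb{A}\times\mathbb{Y}$ satisfying the filtering equation (F). Then the stochastic kernel $q(dz'|z,a)$ on $\mathbb{P}(\mathbb{X})$ given $\mathbb{P}(\mathbb{X})\times\mathbb{A}$ is weakly continuous.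
   Context: For a metric space $\mathbb{S}$, $\mathcal{B}(\mathbb{S})$ is its Borel $\sigma$-field and $\mathbb{P}(\mathbb{S})$ is the set of probability measures on $(\mathbb{S},\mathcal{B}(\mathbb{S}))$ with the topology of weak convergence. Measures $\mu^{(n)}$ converge weakly (setwise) to $\mu$ if $\int f\,d\mu^{(n)}\to\int f\,d\mu$ for every bounded continuous (bounded Borel) $f$. A stochastic kernel $T(ds_1|s_2)$ on $\mathbb{S}_1$ given $\mathbb{S}_2$ satisfies $T(\cdot|s_2)\in\mathbb{P}(\mathbb{S}_1)$ for each $s_2$ and $T(B|\cdot)$ Borel for each $B\in\mathcal{B}(\mathbb{S}_1)$; it is weakly (setwise) continuous if $s_2^{(n)}\to s_2$ implies $T(\cdot|s_2^{(n)})\to T(\cdot|s_2)$ weakly (setwise). For $z\in\mathbb{P}(\mathbb{X})$, $a\in\mathbb{A}$, $B\in\mathcal{B}(\mathbb{X})$, $C\in\mathcal{B}(\mathbb{Y})$ let $R(B\times C|z,a)=\int_{\mathbb{X}}\int_B Q(C|a,x')P(dx'|x,a)z(dx)$ (a stochastic kernel on $\mathbb{X}\times\mathbb{Y}$ given $\mathbb{P}(\mathbb{X})\times\mathbb{A}$) and $R'(C|z,a)=R(\mathbb{X}\times C|z,a)$. There exists a stochastic kernel $H(dx|z,a,y)$ on $\mathbb{X}$ given $\mathbb{P}(\mathbb{X})\times\mathbb{A}\times\mathbb{Y}$ satisfying the filtering equation (F) $R(B\times C|z,a)=\int_C H(B|z,a,y)R'(dy|z,a)$ for all $B,C,z,a$.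 Write $H(z,a,y)=H(\cdot|z,a,y)\in\mathbb{P}(\mathbb{X})$. Define $q(D|z,a)=\int_{\mathbb{Y}}\mathbf{1}\{H(z,a,y)\in D\}R'(dy|z,a)$ for $D\in\mathcal{B}(\mathbb{P}(\mathbb{X}))$; this does not depend on the choice of $H$ satisfying (F). Assumption (H): there exists a stochastic kernel $H$ on $\mathbb{X}$ given $\mathbb{P}(\mathbb{X})\times\mathbb{A}\times\mathbb{Y}$ satisfying (F) such that, if $z^{(n)}\to z$ weakly in $\mathbb{P}(\mathbb{X})$ and $a^{(n)}\to a$ in $\mathbb{A}$, then there exist a subsequence $\{(z^{(n_k)},a^{(n_k)})\}_{k}$ and a measurable set $C\subseteq\mathbb{Y}$ with $R'(C|z,a)=1$ such that $H(z^{(n_k)},a^{(n_k)},y)\to H(z,a,y)$ weakly for all $y\in C$. *)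

theory Defs
  imports "HOL-Probability.Probability"
begin

section \<open>Borel sets, probability measures and convergence\<close>

definition borel_of :: "'a topology \<Rightarrow> 'a measure" where
  "borel_of T = sigma (topspace T) {U. openin T U}"

definition prob_measures :: "'a topology \<Rightarrow> 'a measure set" where
  "prob_measures T = {\<mu>. sets \<mu> = sets (borel_of T) \<and> prob_space \<mu>}"

definition bounded_continuous :: "'a topology \<Rightarrow> ('a \<Rightarrow> real) \<Rightarrow> bool" where
  "bounded_continuous T f \<longleftrightarrow> continuous_map T euclideanreal f \<and> bounded (f ` topspace T)"

definition bounded_borel :: "'a topology \<Rightarrow> ('a \<Rightarrow> real) \<Rightarrow> bool" where
  "bounded_borel T f \<longleftrightarrow> f \<in> borel_measurable (borel_of T) \<and> bounded (f ` topspace T)"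

text \<open>The topology of weak convergence: the coarsest topology on the set of probability measures
  for which every integration map of a bounded continuous function is continuous.\<close>

definition weak_topology :: "'a topology \<Rightarrow> 'a measure topology" where
  "weak_topology T = topology_generated_by
     {{\<mu> \<in> prob_measures T. (\<integral>x. f x \<partial>\<mu>) \<in> U} | f U. bounded_continuous T f \<and> open U}"

definition converges_weakly :: "'a topology \<Rightarrow> (nat \<Rightarrow> 'a measure) \<Rightarrow> 'a measure \<Rightarrow> bool" where
  "converges_weakly T \<mu>s \<mu> \<longleftrightarrow>
     (\<forall>f. bounded_continuous T f \<longrightarrow> (\<lambda>n. \<integral>x. f x \<partial>\<mu>s n) \<longlonglongrightarrow> (\<integral>x. f x \<partial>\<mu>))"

definition converges_setwise :: "'a topology \<Rightarrow> (nat \<Rightarrow> 'a measure) \<Rightarrow> 'a measure \<Rightarrow> bool" where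
  "converges_setwise T \<mu>s \<mu> \<longleftrightarrow>
     (\<forall>f. bounded_borel T f \<longrightarrow> (\<lambda>n. \<integral>x. f x \<partial>\<mu>s n) \<longlonglongrightarrow> (\<integral>x. f x \<partial>\<mu>))"

section \<open>Stochastic kernels\<close>

text \<open>In the following definitions \<open>T1\<close> is the target space and \<open>T2\<close> the conditioning space:
  \<open>\<kappa> s\<close> is the measure \<open>\<kappa>(\<cdot> | s)\<close> on \<open>T1\<close>. Values of \<open>\<kappa>\<close> outside \<open>topspace T2\<close> are irrelevant.\<close>

definition stochastic_kernel :: "'a topology \<Rightarrow> 'b topology \<Rightarrow> ('b \<Rightarrow> 'a measure) \<Rightarrow> bool" where
  "stochastic_kernel T1 T2 \<kappa> \<longleftrightarrow>
     (\<forall>s \<in> topspace T2. \<kappa> s \<in> prob_measures T1) \<and>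
     (\<forall>B \<in> sets (borel_of T1). (\<lambda>s. measure (\<kappa> s) B) \<in> borel_measurable (borel_of T2))"

definition weakly_continuous :: "'a topology \<Rightarrow> 'b topology \<Rightarrow> ('b \<Rightarrow> 'a measure) \<Rightarrow> bool" where
  "weakly_continuous T1 T2 \<kappa> \<longleftrightarrow>
     (\<forall>\<sigma> s. (\<forall>n. \<sigma> n \<in> topspace T2) \<and> limitin T2 \<sigma> s sequentially \<longrightarrow>
        converges_weakly T1 (\<lambda>n. \<kappa> (\<sigma> n)) (\<kappa> s))"

definition setwise_continuous :: "'a topology \<Rightarrow> 'b topology \<Rightarrow> ('b \<Rightarrow> 'a measure) \<Rightarrow> bool" where
  "setwise_continuous T1 T2 \<kappa> \<longleftrightarrow>
     (\<forall>\<sigma> s. (\<forall>n. \<sigma> n \<in> topspace T2) \<and> limitin T2 \<sigma> s sequentially \<longrightarrow>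
        converges_setwise T1 (\<lambda>n. \<kappa> (\<sigma> n)) (\<kappa> s))"

section \<open>The partially observable model\<close>

abbreviation prod_space :: "'x::topological_space set \<Rightarrow> 'y::topological_space set \<Rightarrow> ('x \<times> 'y) topology" where
  "prod_space X Y \<equiv> prod_topology (top_of_set X) (top_of_set Y)"

text \<open>The spaces \<open>\<bbbP>(X) \<times> A\<close> and \<open>\<bbbP>(X) \<times> A \<times> Y\<close>.\<close>

abbreviation belief_action ::
  "'x::topological_space set \<Rightarrow> 'a::topological_space set \<Rightarrow> ('x measure \<times> 'a) topology" where
  "belief_action X A \<equiv> prod_topology (weak_topology (top_of_set X)) (top_of_set A)"

abbreviation belief_action_obs ::
  "'x::topological_space set \<Rightarrow> 'a::topological_space set \<Rightarrow> 'y::topological_space set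
    \<Rightarrow> ('x measure \<times> 'a \<times> 'y) topology" where
  "belief_action_obs X A Y \<equiv> prod_topology (weak_topology (top_of_set X)) (prod_space A Y)"

text \<open>\<open>R(\<cdot> | z, a)\<close> as a measure on all Borel sets of \<open>X \<times> Y\<close>; its defining formula on rectangles is
  \<open>emeasure_joint_kernel_rectangle\<close> below.\<close>

definition joint_kernel :: "'x::topological_space set \<Rightarrow> 'y::topological_space set \<Rightarrow>
    ('x \<times> 'a \<Rightarrow> 'x measure) \<Rightarrow> ('a \<times> 'x \<Rightarrow> 'y measure) \<Rightarrow> 'x measure \<times> 'a \<Rightarrow> ('x \<times> 'y) measure" where
  "joint_kernel X Y P Q = (\<lambda>(z, a). measure_of (X \<times> Y) (sets (borel_of (prod_space X Y)))
     (\<lambda>D. \<integral>\<^sup>+x. (\<integral>\<^sup>+x'. emeasure (Q (a, x')) {y \<in> Y. (x', y) \<in> D} \<partial>P (x, a)) \<partial>z))"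

text \<open>\<open>R'(C | z, a) = R(X \<times> C | z, a)\<close>.\<close>

definition obs_kernel :: "'x::topological_space set \<Rightarrow> 'y::topological_space set \<Rightarrow>
    ('x \<times> 'a \<Rightarrow> 'x measure) \<Rightarrow> ('a \<times> 'x \<Rightarrow> 'y measure) \<Rightarrow> 'x measure \<times> 'a \<Rightarrow> 'y measure" where
  "obs_kernel X Y P Q s = distr (joint_kernel X Y P Q s) (borel_of (top_of_set Y)) snd"

definition filtering_equation :: "'x::topological_space set \<Rightarrow> 'y::topological_space set \<Rightarrow> 'a set \<Rightarrow>
    ('x \<times> 'a \<Rightarrow> 'x measure) \<Rightarrow> ('a \<times> 'x \<Rightarrow> 'y measure) \<Rightarrow> ('x measure \<times> 'a \<times> 'y \<Rightarrow> 'x measure) \<Rightarrow> bool" where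
  "filtering_equation X Y A P Q H \<longleftrightarrow>
     (\<forall>z \<in> prob_measures (top_of_set X). \<forall>a \<in> A.
        \<forall>B \<in> sets (borel_of (top_of_set X)). \<forall>C \<in> sets (borel_of (top_of_set Y)).
          emeasure (joint_kernel X Y P Q (z, a)) (B \<times> C) =
            (\<integral>\<^sup>+y\<in>C. emeasure (H (z, a, y)) B \<partial>obs_kernel X Y P Q (z, a)))"

text \<open>\<open>q(D | z, a)\<close> is the probability under \<open>R'(\<cdot> | z, a)\<close> that \<open>H(z, a, y) \<in> D\<close>.\<close>

definition filter_kernel :: "'x::topological_space set \<Rightarrow> 'y::topological_space set \<Rightarrow>
    ('x \<times> 'a \<Rightarrow> 'x measure) \<Rightarrow> ('a \<times> 'x \<Rightarrow> 'y measure) \<Rightarrow> ('x measure \<times> 'a \<times> 'y \<Rightarrow> 'x measure) \<Rightarrow>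
    'x measure \<times> 'a \<Rightarrow> 'x measure measure" where
  "filter_kernel X Y P Q H = (\<lambda>(z, a).
     distr (obs_kernel X Y P Q (z, a)) (borel_of (weak_topology (top_of_set X))) (\<lambda>y. H (z, a, y)))"

definition assumption_H :: "'x::topological_space set \<Rightarrow> 'y::topological_space set \<Rightarrow>
    'a::topological_space set \<Rightarrow> ('x \<times> 'a \<Rightarrow> 'x measure) \<Rightarrow> ('a \<times> 'x \<Rightarrow> 'y measure) \<Rightarrow> bool" where
  "assumption_H X Y A P Q \<longleftrightarrow>
     (\<exists>H. stochastic_kernel (top_of_set X) (belief_action_obs X A Y) H \<and>
        filtering_equation X Y A P Q H \<and>
        (\<forall>zs z as a.
           (\<forall>n. zs n \<in> prob_measures (top_of_set X)) \<and> z \<in> prob_measures (top_of_set X) \<and>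
           converges_weakly (top_of_set X) zs z \<and>
           (\<forall>n. as n \<in> A) \<and> a \<in> A \<and> as \<longlonglongrightarrow> a \<longrightarrow>
           (\<exists>k C. strict_mono k \<and> C \<in> sets (borel_of (top_of_set Y)) \<and>
              emeasure (obs_kernel X Y P Q (z, a)) C = 1 \<and>
              (\<forall>y \<in> C. converges_weakly (top_of_set X) (\<lambda>n. H (zs (k n), as (k n), y)) (H (z, a, y))))))"

section \<open>Consistency of the definitions\<close>

lemma space_borel_of [simp]: "space (borel_of T) = topspace T"
  unfolding borel_of_def by (rule space_measure_of) (auto dest: openin_subset)

lemma sets_borel_of_top_of_set: "sets (borel_of (top_of_set S)) = sets (restrict_space borel S)"
proof -
  have "sets (restrict_space borel S) = sets (vimage_algebra S (\<lambda>x. x) (sigma UNIV {U. open U}))"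
    unfolding restrict_space_eq_vimage_algebra' borel_def by (simp add: space_measure_of_conv)
  also have "\<dots> = sets (sigma S {(\<lambda>x. x) -` U \<inter> S | U. U \<in> {U. open U}})"
    by (rule arg_cong[where f = sets], rule vimage_algebra_sigma) auto
  also have "{(\<lambda>x. x) -` U \<inter> S | U. U \<in> {U. open U}} = {U. openin (top_of_set S) U}"
    by (auto simp: openin_open)
  finally show ?thesis by (simp add: borel_of_def)
qed

lemma topspace_weak_topology [simp]: "topspace (weak_topology T) = prob_measures T"
proof -
  have "bounded_continuous T (\<lambda>x. 0)"
    by (simp add: bounded_continuous_def image_constant_conv)
  moreover have "prob_measures T = {\<mu> \<in> prob_measures T. (\<integral>x. 0 \<partial>\<mu>) \<in> (UNIV :: real set)}"
    by simp
  ultimately have "prob_measures T \<in> {{\<mu> \<in> prob_measures T. (\<integral>x. f x \<partial>\<mu>) \<in> U} | f U. bounded_continuous T f \<and> open U}"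
    using open_UNIV by (intro CollectI exI conjI)
  then show ?thesis
    unfolding weak_topology_def topology_generated_by_topspace
    by (intro equalityI Union_upper Union_least) auto
qed

lemma limitin_weak_topology_iff:
  "limitin (weak_topology T) \<mu>s \<mu> sequentially \<longleftrightarrow>
     \<mu> \<in> prob_measures T \<and> (\<forall>\<^sub>F n in sequentially. \<mu>s n \<in> prob_measures T) \<and> converges_weakly T \<mu>s \<mu>"
  (is "?L \<longleftrightarrow> ?R")
proof
  assume L: ?L
  have mem: "\<mu> \<in> prob_measures T" using limitin_topspace[OF L] by simp
  have ev: "\<forall>\<^sub>F n in sequentially. \<mu>s n \<in> prob_measures T"
    using L mem unfolding limitin_def by (metis openin_topspace topspace_weak_topology)
  have "(\<lambda>n. \<integral>x. f x \<partial>\<mu>s n) \<longlonglongrightarrow> (\<integral>x. f x \<partial>\<mu>)" if f: "bounded_continuous T f" for f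
  proof (rule topological_tendstoI)
    fix U :: "real set" assume U: "open U" "(\<integral>x. f x \<partial>\<mu>) \<in> U"
    have "openin (weak_topology T) {\<mu> \<in> prob_measures T. (\<integral>x. f x \<partial>\<mu>) \<in> U}"
      unfolding weak_topology_def using f U(1) by (intro topology_generated_by_Basis) auto
    then have "\<forall>\<^sub>F n in sequentially. \<mu>s n \<in> {\<mu> \<in> prob_measures T. (\<integral>x. f x \<partial>\<mu>) \<in> U}"
      using L U(2) mem unfolding limitin_def by blast
    then show "\<forall>\<^sub>F n in sequentially. (\<integral>x. f x \<partial>\<mu>s n) \<in> U"
      by (auto elim: eventually_mono)
  qed
  with mem ev show ?R by (auto simp: converges_weakly_def)
next
  assume R: ?R
  let ?S = "{{\<mu> \<in> prob_measures T. (\<integral>x. f x \<partial>\<mu>) \<in> U} | f U. bounded_continuous T f \<and> open U}"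
  have "\<forall>\<^sub>F n in sequentially. \<mu>s n \<in> V" if "generate_topology_on ?S V" "\<mu> \<in> V" for V
    using that
  proof (induction rule: generate_topology_on.induct)
    case (Int a b) then show ?case by (simp add: eventually_conj)
  next
    case (UN K)
    then obtain k where "k \<in> K" "\<mu> \<in> k" by blast
    with UN.IH[of k] have "\<forall>\<^sub>F n in sequentially. \<mu>s n \<in> k" by simp
    then show ?case by (rule eventually_mono) (use \<open>k \<in> K\<close> in blast)
  next
    case (Basis s)
    then obtain f U where fU: "bounded_continuous T f" "open U"
      "s = {\<mu> \<in> prob_measures T. (\<integral>x. f x \<partial>\<mu>) \<in> U}" by blast
    have "\<forall>\<^sub>F n in sequentially. (\<integral>x. f x \<partial>\<mu>s n) \<in> U"
      using R fU Basis.prems unfolding converges_weakly_def by (auto intro: topological_tendstoD)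
    with R show ?case unfolding fU by (auto intro: eventually_conj)
  qed auto
  moreover have "generate_topology_on ?S V" if "openin (weak_topology T) V" for V
    using that unfolding weak_topology_def by (rule openin_topology_generated_by)
  moreover have "\<mu> \<in> topspace (weak_topology T)" using R by simp
  ultimately show ?L unfolding limitin_def by blast
qed

lemma prod_space_eq: "prod_space X Y = top_of_set (X \<times> Y)"
  by (simp add: subtopology_Times[of euclidean euclidean, symmetric, simplified])

lemma sets_borel_of_prod_space:
  fixes X :: "'x::second_countable_topology set" and Y :: "'y::second_countable_topology set"
  shows "sets (borel_of (prod_space X Y)) = sets (borel_of (top_of_set X) \<Otimes>\<^sub>M borel_of (top_of_set Y))"
    (is "?L = ?R")
proof
  let ?M = "borel_of (top_of_set X)" and ?N = "borel_of (top_of_set Y)"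
  have L: "?L = sets (restrict_space (borel \<Otimes>\<^sub>M borel) (X \<times> Y))"
    unfolding prod_space_eq sets_borel_of_top_of_set borel_prod ..
  have idM: "(\<lambda>x. x) \<in> ?M \<rightarrow>\<^sub>M borel" and idN: "(\<lambda>x. x) \<in> ?N \<rightarrow>\<^sub>M borel"
    by (subst measurable_cong_sets[OF sets_borel_of_top_of_set refl], rule measurable_restrict_space1, simp)+
  have "(\<lambda>p. (fst p, snd p)) \<in> (?M \<Otimes>\<^sub>M ?N) \<rightarrow>\<^sub>M (borel \<Otimes>\<^sub>M borel)"
    by (intro measurable_Pair measurable_compose[OF measurable_fst idM] measurable_compose[OF measurable_snd idN])
  then have id: "(\<lambda>p. p) \<in> (?M \<Otimes>\<^sub>M ?N) \<rightarrow>\<^sub>M (borel \<Otimes>\<^sub>M borel)" by simp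
  show "?L \<subseteq> ?R"
  proof
    fix D assume "D \<in> ?L"
    then obtain V where V: "V \<in> sets (borel \<Otimes>\<^sub>M borel)" "D = (X \<times> Y) \<inter> V"
      unfolding L sets_restrict_space by auto
    have "(\<lambda>p. p) -` V \<inter> space (?M \<Otimes>\<^sub>M ?N) \<in> ?R" using measurable_sets[OF id V(1)] .
    then show "D \<in> ?R" unfolding V(2) by (simp add: space_pair_measure Int_commute)
  qed
  have "B \<times> C \<in> ?L" if BC: "B \<in> sets ?M" "C \<in> sets ?N" for B C
  proof -
    obtain B' C' where "B' \<in> sets borel" "B = X \<inter> B'" "C' \<in> sets borel" "C = Y \<inter> C'"
      using BC unfolding sets_borel_of_top_of_set sets_restrict_space by auto
    then show ?thesis unfolding L sets_restrict_space
      by (auto intro!: image_eqI[of _ _ "B' \<times> C'"])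
  qed
  moreover have "space (borel_of (prod_space X Y)) = space ?M \<times> space ?N" by simp
  ultimately show "?R \<subseteq> ?L"
    unfolding sets_pair_measure
    by (elim subst) (intro sets.sigma_sets_subset; blast)
qed

lemma stochastic_kernel_measurable:
  assumes "stochastic_kernel T1 T2 \<kappa>"
  shows "\<kappa> \<in> borel_of T2 \<rightarrow>\<^sub>M prob_algebra (borel_of T1)"
proof (rule measurable_prob_algebraI)
  have \<kappa>: "sets (\<kappa> s) = sets (borel_of T1)" "prob_space (\<kappa> s)" if "s \<in> topspace T2" for s
    using assms that by (auto simp: stochastic_kernel_def prob_measures_def)
  then show "\<And>s. s \<in> space (borel_of T2) \<Longrightarrow> prob_space (\<kappa> s)" by simp
  show "\<kappa> \<in> borel_of T2 \<rightarrow>\<^sub>M subprob_algebra (borel_of T1)"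
  proof (rule measurable_subprob_algebra)
    fix B assume "B \<in> sets (borel_of T1)"
    then have "(\<lambda>s. ennreal (measure (\<kappa> s) B)) \<in> borel_measurable (borel_of T2)"
      using assms by (auto simp: stochastic_kernel_def)
    also have "?this \<longleftrightarrow> (\<lambda>s. emeasure (\<kappa> s) B) \<in> borel_measurable (borel_of T2)"
      by (intro measurable_cong)
        (metis \<kappa>(2) finite_measure.emeasure_eq_measure prob_space_def space_borel_of)
    finally show "(\<lambda>s. emeasure (\<kappa> s) B) \<in> borel_measurable (borel_of T2)" .
  qed (use \<kappa> in \<open>auto intro: prob_space_imp_subprob_space\<close>)
qed

context
  fixes X :: "'x::second_countable_topology set" and Y :: "'y::second_countable_topology set"
    and A :: "'a::second_countable_topology set"
    and P :: "'x \<times> 'a \<Rightarrow> 'x measure" and Q :: "'a \<times> 'x \<Rightarrow> 'y measure"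
  assumes P: "stochastic_kernel (top_of_set X) (prod_space X A) P"
    and Q: "stochastic_kernel (top_of_set Y) (prod_space A X) Q"
begin

lemma P_measurable:
  assumes "a \<in> A"
  shows "(\<lambda>x. P (x, a)) \<in> borel_of (top_of_set X) \<rightarrow>\<^sub>M prob_algebra (borel_of (top_of_set X))"
proof -
  have "P \<in> (borel_of (top_of_set X) \<Otimes>\<^sub>M borel_of (top_of_set A)) \<rightarrow>\<^sub>M prob_algebra (borel_of (top_of_set X))"
    using stochastic_kernel_measurable[OF P] unfolding measurable_cong_sets[OF sets_borel_of_prod_space refl] .
  from measurable_compose[OF measurable_Pair2'[of a] this] assms show ?thesis by simp
qed

lemma Q_measurable:
  assumes "a \<in> A"
  shows "(\<lambda>x. Q (a, x)) \<in> borel_of (top_of_set X) \<rightarrow>\<^sub>M prob_algebra (borel_of (top_of_set Y))"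
proof -
  have "Q \<in> (borel_of (top_of_set A) \<Otimes>\<^sub>M borel_of (top_of_set X)) \<rightarrow>\<^sub>M prob_algebra (borel_of (top_of_set Y))"
    using stochastic_kernel_measurable[OF Q] unfolding measurable_cong_sets[OF sets_borel_of_prod_space refl] .
  from measurable_compose[OF measurable_Pair1'[of a] this] assms show ?thesis by simp
qed

lemma section_measurable:
  assumes a: "a \<in> A" and D: "D \<in> sets (borel_of (prod_space X Y))"
  shows "(\<lambda>x'. emeasure (Q (a, x')) {y \<in> Y. (x', y) \<in> D}) \<in> borel_measurable (borel_of (top_of_set X))"
proof (rule emeasure_measurable_subprob_algebra2)
  have "D \<subseteq> X \<times> Y" using sets.sets_into_space[OF D] by simp
  then have "(SIGMA x':space (borel_of (top_of_set X)). {y \<in> Y. (x', y) \<in> D}) = D" by auto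
  then show "(SIGMA x':space (borel_of (top_of_set X)). {y \<in> Y. (x', y) \<in> D})
      \<in> sets (borel_of (top_of_set X) \<Otimes>\<^sub>M borel_of (top_of_set Y))"
    using D unfolding sets_borel_of_prod_space by simp
  show "(\<lambda>x'. Q (a, x')) \<in> borel_of (top_of_set X) \<rightarrow>\<^sub>M subprob_algebra (borel_of (top_of_set Y))"
    by (rule measurable_prob_algebraD[OF Q_measurable[OF a]])
qed

lemma section_sets:
  assumes a: "a \<in> A" and x': "x' \<in> X" and D: "D \<in> sets (borel_of (prod_space X Y))"
  shows "{y \<in> Y. (x', y) \<in> D} \<in> sets (Q (a, x'))"
proof -
  have "D \<subseteq> X \<times> Y" using sets.sets_into_space[OF D] by simp
  then have "{y \<in> Y. (x', y) \<in> D} = Pair x' -` D" by auto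
  also have "\<dots> \<in> sets (borel_of (top_of_set Y))"
    using D unfolding sets_borel_of_prod_space by (rule sets_Pair1)
  also have "\<dots> = sets (Q (a, x'))"
    using Q a x' by (auto simp: stochastic_kernel_def prob_measures_def)
  finally show ?thesis .
qed

lemma sets_joint_kernel [simp]:
  "sets (joint_kernel X Y P Q (z, a)) = sets (borel_of (prod_space X Y))"
  using sets.sets_measure_of_eq[of "borel_of (prod_space X Y)"] by (simp add: joint_kernel_def)

lemma space_joint_kernel [simp]: "space (joint_kernel X Y P Q (z, a)) = X \<times> Y"
  using sets_eq_imp_space_eq[OF sets_joint_kernel] by simp

lemma emeasure_joint_kernel:
  assumes z: "z \<in> prob_measures (top_of_set X)" and a: "a \<in> A"
    and D: "D \<in> sets (borel_of (prod_space X Y))"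
  shows "emeasure (joint_kernel X Y P Q (z, a)) D =
    (\<integral>\<^sup>+x. (\<integral>\<^sup>+x'. emeasure (Q (a, x')) {y \<in> Y. (x', y) \<in> D} \<partial>P (x, a)) \<partial>z)"
proof -
  let ?M = "borel_of (prod_space X Y)" and ?X = "borel_of (top_of_set X)"
  define g where "g = (\<lambda>D x'. emeasure (Q (a, x')) {y \<in> Y. (x', y) \<in> D})"
  define \<mu> where "\<mu> = (\<lambda>D. \<integral>\<^sup>+x. (\<integral>\<^sup>+x'. g D x' \<partial>P (x, a)) \<partial>z)"
  have setsz: "sets z = sets ?X" using z by (simp add: prob_measures_def)
  then have spz: "space z = X" using sets_eq_imp_space_eq[OF setsz] by simp
  have setsP: "sets (P (x, a)) = sets ?X" if "x \<in> X" for x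
    using P that a by (auto simp: stochastic_kernel_def prob_measures_def)
  then have spP: "space (P (x, a)) = X" if "x \<in> X" for x
    using sets_eq_imp_space_eq[OF setsP] that by simp
  have gm: "g D \<in> borel_measurable ?X" if "D \<in> sets ?M" for D
    unfolding g_def by (rule section_measurable[OF a that])
  have Pm: "(\<lambda>x. P (x, a)) \<in> ?X \<rightarrow>\<^sub>M subprob_algebra ?X"
    by (rule measurable_prob_algebraD[OF P_measurable[OF a]])
  have im: "(\<lambda>x. \<integral>\<^sup>+x'. g D x' \<partial>P (x, a)) \<in> borel_measurable ?X" if "D \<in> sets ?M" for D
    by (rule measurable_compose[OF Pm nn_integral_measurable_subprob_algebra[OF gm[OF that]]])
  have ca: "countably_additive (sets ?M) \<mu>"
  proof (rule countably_additiveI)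
    fix F :: "nat \<Rightarrow> ('x \<times> 'y) set"
    assume F: "range F \<subseteq> sets ?M" "disjoint_family F" "(\<Union>i. F i) \<in> sets ?M"
    then have Fi: "F i \<in> sets ?M" for i by auto
    have g: "g (\<Union>i. F i) x' = (\<Sum>i. g (F i) x')" if "x' \<in> X" for x'
    proof -
      have "(\<Sum>i. emeasure (Q (a, x')) {y \<in> Y. (x', y) \<in> F i}) =
          emeasure (Q (a, x')) (\<Union>i. {y \<in> Y. (x', y) \<in> F i})"
        using section_sets[OF a that Fi] F(2)
        by (intro suminf_emeasure) (auto simp: disjoint_family_on_def)
      also have "(\<Union>i. {y \<in> Y. (x', y) \<in> F i}) = {y \<in> Y. (x', y) \<in> (\<Union>i. F i)}" by auto
      finally show ?thesis by (simp add: g_def)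
    qed
    have inner: "(\<integral>\<^sup>+x'. g (\<Union>i. F i) x' \<partial>P (x, a)) = (\<Sum>i. \<integral>\<^sup>+x'. g (F i) x' \<partial>P (x, a))" if "x \<in> X" for x
    proof -
      have "(\<integral>\<^sup>+x'. g (\<Union>i. F i) x' \<partial>P (x, a)) = (\<integral>\<^sup>+x'. (\<Sum>i. g (F i) x') \<partial>P (x, a))"
        by (intro nn_integral_cong) (simp add: spP that g)
      also have "\<dots> = (\<Sum>i. \<integral>\<^sup>+x'. g (F i) x' \<partial>P (x, a))"
        by (intro nn_integral_suminf) (use gm[OF Fi] in \<open>simp add: measurable_cong_sets[OF setsP[OF that] refl]\<close>)
      finally show ?thesis .
    qed
    have "\<mu> (\<Union>i. F i) = (\<integral>\<^sup>+x. (\<Sum>i. \<integral>\<^sup>+x'. g (F i) x' \<partial>P (x, a)) \<partial>z)"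
      unfolding \<mu>_def by (intro nn_integral_cong) (simp add: spz inner)
    also have "\<dots> = (\<Sum>i. \<mu> (F i))"
      unfolding \<mu>_def by (intro nn_integral_suminf) (use im[OF Fi] in \<open>simp add: measurable_cong_sets[OF setsz refl]\<close>)
    finally show "(\<Sum>i. \<mu> (F i)) = \<mu> (\<Union>i. F i)" by simp
  qed
  have pos: "positive (sets ?M) \<mu>" by (simp add: positive_def \<mu>_def g_def)
  have sa: "sigma_algebra (X \<times> Y) (sets ?M)" using sets.sigma_algebra_axioms[of ?M] by simp
  have "emeasure (measure_of (X \<times> Y) (sets ?M) \<mu>) D = \<mu> D"
    by (rule emeasure_measure_of_sigma[OF sa pos ca D])
  then show ?thesis by (simp add: joint_kernel_def \<mu>_def g_def)
qed

lemma emeasure_joint_kernel_rectangle: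
  assumes z: "z \<in> prob_measures (top_of_set X)" and a: "a \<in> A"
    and B: "B \<in> sets (borel_of (top_of_set X))" and C: "C \<in> sets (borel_of (top_of_set Y))"
  shows "emeasure (joint_kernel X Y P Q (z, a)) (B \<times> C) =
    (\<integral>\<^sup>+x. (\<integral>\<^sup>+x'\<in>B. emeasure (Q (a, x')) C \<partial>P (x, a)) \<partial>z)"
proof -
  have D: "B \<times> C \<in> sets (borel_of (prod_space X Y))"
    unfolding sets_borel_of_prod_space using B C by simp
  have "C \<subseteq> Y" using sets.sets_into_space[OF C] by simp
  then have "emeasure (Q (a, x')) {y \<in> Y. (x', y) \<in> B \<times> C} = emeasure (Q (a, x')) C * indicator B x'" for x'
    by (auto simp: indicator_def intro!: arg_cong[where f = "emeasure _"])
  then show ?thesis by (simp add: emeasure_joint_kernel[OF z a D])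
qed

lemma emeasure_obs_kernel:
  assumes C: "C \<in> sets (borel_of (top_of_set Y))"
  shows "emeasure (obs_kernel X Y P Q (z, a)) C = emeasure (joint_kernel X Y P Q (z, a)) (X \<times> C)"
proof -
  have "C \<subseteq> Y" using sets.sets_into_space[OF C] by simp
  moreover have "snd \<in> joint_kernel X Y P Q (z, a) \<rightarrow>\<^sub>M borel_of (top_of_set Y)"
    unfolding measurable_cong_sets[OF sets_joint_kernel refl]
      measurable_cong_sets[OF sets_borel_of_prod_space refl] by (rule measurable_snd)
  ultimately show ?thesis
    unfolding obs_kernel_def using C
    by (subst emeasure_distr) (auto intro!: arg_cong[where f = "emeasure _"])
qed

end

end

theory Submission
  imports Defs
begin

text \<open>Two filters satisfying (F) agree almost surely under \<open>R'(\<cdot> | z, a)\<close>, so \<open>q\<close> may be computed from the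
  filter \<open>H\<close> provided by the hypothesis, and the integral of \<open>F\<close> against \<open>q(\<cdot> | z, a)\<close> is that of
  \<open>y \<mapsto> F (H(z, a, y))\<close> against \<open>R'(\<cdot> | z, a)\<close>.
  In case (i) these integrands converge almost surely along a subsequence while the measures converge setwise,
  and a dominated convergence argument for setwise convergent measures applies.
  In case (ii) the integrands converge continuously, i.e. \<open>G\<^sub>n(y\<^sub>n) \<rightarrow> G(y)\<close> whenever \<open>y\<^sub>n \<rightarrow> y\<close>; this together with
  weak convergence of the measures suffices for convergence of the integrals, and applying the same
  principle to the inner integrals over \<open>Q\<close> and \<open>P\<close> shows that \<open>R'\<close> is weakly continuous.
  That \<open>q\<close> is a kernel rests on the weak topology being second countable, which makes its Borel sets
  those generated by the evaluations \<open>\<mu> \<mapsto> \<mu>(B)\<close>.\<close>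

section \<open>Borel sets and probability measures\<close>

text \<open>The obstacle to continuity is that integrand and measure move together, whereas weak and
  setwise convergence test only one fixed function at a time. In both regimes the remedy is to
  compress a whole tail \<open>n \<ge> N\<close> of integrands into a single admissible test
  function: the indicator of the set where some later integrand deviates (Borel, hence allowed for
  setwise convergence), or a penalised infimum over the tail (Lipschitz, hence allowed for weak
  convergence). \<open>N\<close> is fixed by means of the limit measure alone, and only then does
  \<open>n\<close> tend to infinity.

  The obstacle to measurability is that weakly open sets come from uncountably many integrals, while
  kernels are specified by evaluations on Borel sets. One countable family of Lipschitz functions
  bridges the two, because it approximates every bounded nonnegative lower semicontinuous function
  from below by a sequence that does not depend on the measure. Continuous functions then give a
  countable base, and indicators of open sets give measurability of the evaluations.\<close>

lemma sets_borel_of: "sets (borel_of T) = sigma_sets (topspace T) {U. openin T U}"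
  unfolding borel_of_def by (rule sets_measure_of) (auto dest: openin_subset)

lemma openin_borel_of: "openin T U \<Longrightarrow> U \<in> sets (borel_of T)"
  by (simp add: sets_borel_of)

lemma measurable_borel_ofI:
  assumes "\<And>x. x \<in> space M \<Longrightarrow> f x \<in> topspace T"
    and "\<And>U. openin T U \<Longrightarrow> f -` U \<inter> space M \<in> sets M"
  shows "f \<in> M \<rightarrow>\<^sub>M borel_of T"
  unfolding borel_of_def
  by (rule measurable_measure_of) (use assms in \<open>auto dest: openin_subset\<close>)

lemma continuous_map_borel_measurable:
  fixes f :: "'a \<Rightarrow> 'b::topological_space"
  assumes "continuous_map T euclidean f"
  shows "f \<in> borel_measurable (borel_of T)"
proof (rule borel_measurableI)
  fix S :: "'b set" assume "open S"
  then have "openin T {x \<in> topspace T. f x \<in> S}"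
    using assms by (auto simp: continuous_map_def)
  moreover have "f -` S \<inter> space (borel_of T) = {x \<in> topspace T. f x \<in> S}" by auto
  ultimately show "f -` S \<inter> space (borel_of T) \<in> sets (borel_of T)"
    by (simp add: openin_borel_of)
qed

lemma prob_measuresD:
  assumes "\<mu> \<in> prob_measures T"
  shows "sets \<mu> = sets (borel_of T)" "space \<mu> = topspace T" "prob_space \<mu>"
  using assms sets_eq_imp_space_eq[of \<mu> "borel_of T"] by (auto simp: prob_measures_def)

lemma prob_measures_measurable:
  assumes "\<mu> \<in> prob_measures T" "f \<in> borel_measurable (borel_of T)"
  shows "f \<in> borel_measurable \<mu>"
  using assms(2) by (simp add: measurable_cong_sets[OF prob_measuresD(1)[OF assms(1)] refl])

lemma prob_measures_integrable:
  fixes f :: "'a \<Rightarrow> real"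
  assumes "\<mu> \<in> prob_measures T" "f \<in> borel_measurable (borel_of T)"
    and "\<And>x. x \<in> topspace T \<Longrightarrow> \<bar>f x\<bar> \<le> M"
  shows "integrable \<mu> f"
proof -
  interpret prob_space \<mu> using prob_measuresD(3)[OF assms(1)] .
  show ?thesis
    by (rule integrable_const_bound[of _ M])
      (use assms(3) prob_measuresD(2)[OF assms(1)] prob_measures_measurable[OF assms(1,2)] in auto)
qed

lemma prob_measures_bounded_convergence:
  fixes f :: "'a \<Rightarrow> real"
  assumes \<mu>: "\<mu> \<in> prob_measures T" and "\<And>n. F n \<in> borel_measurable (borel_of T)"
    and "\<And>n x. x \<in> topspace T \<Longrightarrow> \<bar>F n x\<bar> \<le> M"
    and lim: "\<And>x. x \<in> topspace T \<Longrightarrow> (\<lambda>n. F n x) \<longlonglongrightarrow> f x"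
  shows "(\<lambda>n. \<integral>x. F n x \<partial>\<mu>) \<longlonglongrightarrow> (\<integral>x. f x \<partial>\<mu>)"
proof -
  interpret prob_space \<mu> using prob_measuresD(3)[OF \<mu>] .
  have "f \<in> borel_measurable (borel_of T)"
    by (rule borel_measurable_LIMSEQ_metric[OF assms(2)]) (use lim in auto)
  then show ?thesis
    by (intro integral_dominated_convergence[where w = "\<lambda>_. M"])
      (use assms(3) lim in \<open>auto simp: prob_measuresD(2)[OF \<mu>]
        intro!: prob_measures_measurable[OF \<mu>] assms(2) AE_I2\<close>)
qed

lemma prob_measures_integral_abs_le:
  fixes f :: "'a \<Rightarrow> real"
  assumes \<mu>: "\<mu> \<in> prob_measures T" and f: "f \<in> borel_measurable (borel_of T)"
    and bound: "\<And>x. x \<in> topspace T \<Longrightarrow> \<bar>f x\<bar> \<le> M"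
  shows "\<bar>\<integral>x. f x \<partial>\<mu>\<bar> \<le> M"
proof -
  interpret prob_space \<mu> using prob_measuresD(3)[OF \<mu>] .
  have "\<bar>\<integral>x. f x \<partial>\<mu>\<bar> \<le> (\<integral>x. \<bar>f x\<bar> \<partial>\<mu>)" by (rule integral_abs_bound)
  also have "\<dots> \<le> (\<integral>x. M \<partial>\<mu>)"
    using prob_measures_integrable[OF \<mu> f bound] bound prob_measuresD(2)[OF \<mu>]
    by (intro integral_mono) auto
  finally show ?thesis by (simp add: prob_space)
qed

section \<open>Countable bases, countable generators and product Borel sets\<close>

lemma second_countable_top_of_set:
  "second_countable (top_of_set (S :: 'a::second_countable_topology set))"
proof (rule second_countable_subtopology)
  obtain B :: "'a set set" where B: "countable B" "topological_basis B"
    using ex_countable_basis by blast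
  then have "\<forall>V\<in>B. open V" "\<forall>U x. open U \<and> x \<in> U \<longrightarrow> (\<exists>V\<in>B. x \<in> V \<and> V \<subseteq> U)"
    by (meson topological_basis_open, meson topological_basisE)
  with B(1) show "second_countable (euclidean :: 'a topology)"
    unfolding second_countable_def by (intro exI[of _ B]) (auto simp: open_openin[symmetric])
qed

text \<open>Finite intersections of a countable base form a countable pi-system, and every open set
  is a countable union of base members. Countability matters for the uniqueness of filters, where
  one null set has to serve all generators at once.\<close>

lemma countable_generator_borel_of:
  assumes "second_countable T"
  obtains G where "countable G" "Int_stable G" "topspace T \<in> G" "G \<subseteq> Pow (topspace T)"
    "sets (borel_of T) = sigma_sets (topspace T) G"
proof -
  obtain B where B: "countable B" "\<forall>V\<in>B. openin T V"
    "\<forall>U x. openin T U \<and> x \<in> U \<longrightarrow> (\<exists>V\<in>B. x \<in> V \<and> V \<subseteq> U)"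
    using assms unfolding second_countable_def by (elim exE conjE)
  \<comment> \<open>The intersection with \<open>topspace T\<close> makes the empty family
    contribute the whole space instead of \<open>UNIV\<close>.\<close>
  define G where "G = (\<lambda>F. topspace T \<inter> \<Inter>F) ` {F. finite F \<and> F \<subseteq> B}"
  have count: "countable G" unfolding G_def
    by (intro countable_image countable_Collect_finite_subset B(1))
  have Pow: "G \<subseteq> Pow (topspace T)" by (auto simp: G_def)
  have BG: "B \<subseteq> G"
  proof
    fix V assume V: "V \<in> B"
    then have "V = topspace T \<inter> \<Inter>{V}" using B(2) openin_subset by auto
    with V show "V \<in> G" unfolding G_def by blast
  qed
  have Int: "Int_stable G"
  proof (rule Int_stableI)
    fix V V' assume "V \<in> G" "V' \<in> G"
    then obtain F F' where "finite F" "F \<subseteq> B" "V = topspace T \<inter> \<Inter>F"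
      "finite F'" "F' \<subseteq> B" "V' = topspace T \<inter> \<Inter>F'" unfolding G_def by auto
    then show "V \<inter> V' \<in> G" unfolding G_def by (intro image_eqI[of _ _ "F \<union> F'"]) auto
  qed
  have top: "topspace T \<in> G" unfolding G_def by (intro image_eqI[of _ _ "{}"]) auto
  have "openin T V" if V: "V \<in> G" for V
  proof -
    obtain F where F: "finite F" "F \<subseteq> B" "V = topspace T \<inter> \<Inter>F" using V unfolding G_def by auto
    from F(1,2) have "openin T (topspace T \<inter> \<Inter>F)"
    proof (induction F)
      case (insert U F)
      then have "openin T (U \<inter> (topspace T \<inter> \<Inter>F))" using B(2) by auto
      then show ?case by (simp add: Int_left_commute)
    qed simp
    with F(3) show ?thesis by simp
  qed
  moreover have "U \<in> sigma_sets (topspace T) G" if U: "openin T U" for U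
  proof -
    have "U = \<Union>{V \<in> B. V \<subseteq> U}" using B(3) U by blast
    also have "\<dots> \<in> sigma_sets (topspace T) G"
      using BG by (intro sigma_sets_UNION countable_subset[OF _ B(1)]) auto
    finally show ?thesis .
  qed
  ultimately have "sets (borel_of T) = sigma_sets (topspace T) G"
    unfolding sets_borel_of by (intro sigma_sets_eqI) auto
  from that[OF count Int top Pow this] show thesis .
qed

text \<open>An open set of the product is a union of rectangles from the two countable bases, hence
  a countable union of measurable rectangles. The abstract form is needed because one factor will be
  the space of measures with its weak topology.\<close>

lemma borel_of_prod_topology:
  assumes "second_countable T1" "second_countable T2"
  shows "sets (borel_of (prod_topology T1 T2)) = sets (borel_of T1 \<Otimes>\<^sub>M borel_of T2)"
    (is "?L = ?R")
proof
  obtain B1 where B1: "countable B1" "\<forall>V\<in>B1. openin T1 V"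
    "\<forall>U x. openin T1 U \<and> x \<in> U \<longrightarrow> (\<exists>V\<in>B1. x \<in> V \<and> V \<subseteq> U)"
    using assms(1) unfolding second_countable_def by (elim exE conjE)
  obtain B2 where B2: "countable B2" "\<forall>V\<in>B2. openin T2 V"
    "\<forall>U x. openin T2 U \<and> x \<in> U \<longrightarrow> (\<exists>V\<in>B2. x \<in> V \<and> V \<subseteq> U)"
    using assms(2) unfolding second_countable_def by (elim exE conjE)
  have "U \<in> ?R" if U: "openin (prod_topology T1 T2) U" for U
  proof -
    have "\<exists>V\<in>B1. \<exists>W\<in>B2. (x, y) \<in> V \<times> W \<and> V \<times> W \<subseteq> U" if xy: "(x, y) \<in> U" for x y
    proof -
      obtain V W where VW: "openin T1 V" "openin T2 W" "x \<in> V" "y \<in> W" "V \<times> W \<subseteq> U"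
        using U[unfolded openin_prod_topology_alt, rule_format, OF xy] by (elim exE conjE)
      obtain V' W' where "V' \<in> B1" "x \<in> V'" "V' \<subseteq> V" "W' \<in> B2" "y \<in> W'" "W' \<subseteq> W"
        using B1(3) B2(3) VW by meson
      with VW(5) show ?thesis by (intro bexI[of _ V'] bexI[of _ W']) auto
    qed
    then have "U = (\<Union>(V, W)\<in>{(V, W) \<in> B1 \<times> B2. V \<times> W \<subseteq> U}. V \<times> W)" by fast
    also have "\<dots> \<in> ?R"
      using B1(1,2) B2(1,2)
      by (intro sets.countable_UN') (auto intro: countable_subset[of _ "B1 \<times> B2"] openin_borel_of)
    finally show ?thesis .
  qed
  then show "?L \<subseteq> ?R"
    unfolding sets_borel_of[of "prod_topology T1 T2"]
    by (subst topspace_prod_topology, subst space_borel_of[symmetric, of T1],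
        subst space_borel_of[symmetric, of T2], subst space_pair_measure[symmetric])
      (intro sets.sigma_sets_subset, auto)
  have "{p \<in> topspace T1 \<times> topspace T2. fst p \<in> U} = U \<times> topspace T2" if "openin T1 U" for U
    using openin_subset[OF that] by auto
  then have fst: "fst \<in> borel_of (prod_topology T1 T2) \<rightarrow>\<^sub>M borel_of T1"
    by (intro measurable_borel_ofI)
      (auto simp: vimage_def Int_def conj_commute openin_prod_Times_iff intro!: openin_borel_of)
  have "{p \<in> topspace T1 \<times> topspace T2. snd p \<in> U} = topspace T1 \<times> U" if "openin T2 U" for U
    using openin_subset[OF that] by auto
  then have "snd \<in> borel_of (prod_topology T1 T2) \<rightarrow>\<^sub>M borel_of T2"
    by (intro measurable_borel_ofI)
      (auto simp: vimage_def Int_def conj_commute openin_prod_Times_iff intro!: openin_borel_of)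
  with fst have id: "(\<lambda>p. (fst p, snd p)) \<in> borel_of (prod_topology T1 T2) \<rightarrow>\<^sub>M (borel_of T1 \<Otimes>\<^sub>M borel_of T2)"
    by (rule measurable_Pair)
  show "?R \<subseteq> ?L"
  proof
    fix D assume D: "D \<in> ?R"
    have "D = (\<lambda>p. (fst p, snd p)) -` D \<inter> space (borel_of (prod_topology T1 T2))"
      using sets.sets_into_space[OF D] by (auto simp: space_pair_measure)
    with measurable_sets[OF id D] show "D \<in> ?L" by simp
  qed
qed

section \<open>Second countability of the weak topology\<close>

text \<open>A triple \<open>(q, k, c)\<close> encodes the downward cone with apex height
  \<open>q\<close>, slope \<open>k\<close> and centre \<open>c\<close>. Taking only finitely many
  cones keeps the maximum Lipschitz and bounded above, and the value 0 for the empty list truncates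
  it below, so it is a bounded continuous test function.\<close>

fun cone_sup :: "(real \<times> nat \<times> 'a::metric_space) list \<Rightarrow> 'a \<Rightarrow> real" where
  "cone_sup [] x = 0"
| "cone_sup ((q, k, c) # l) x = max (q - real k * dist x c) (cone_sup l x)"

lemma cone_sup_le_iff:
  "cone_sup l x \<le> r \<longleftrightarrow> 0 \<le> r \<and> (\<forall>(q, k, c) \<in> set l. q - real k * dist x c \<le> r)"
  by (induction l x rule: cone_sup.induct) auto

lemma cone_sup_nonneg: "0 \<le> cone_sup l x"
  by (induction l x rule: cone_sup.induct) auto

lemma continuous_on_cone_sup: "continuous_on S (cone_sup l)"
  by (induction l) (auto intro!: continuous_intros)

lemma cone_sup_bounded: "\<exists>M. \<forall>x. cone_sup l x \<le> M"
proof (induction l)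
  case (Cons t l)
  obtain q k c where t: "t = (q, k, c)" by (cases t)
  from Cons obtain M where M: "\<forall>x. cone_sup l x \<le> M" by auto
  have "q - real k * dist x c \<le> q" for x by simp
  then have "cone_sup (t # l) x \<le> max q M" for x
    unfolding t cone_sup.simps using M by (intro max.mono) auto
  then show ?case by blast
qed auto

lemma bounded_continuous_cone_sup: "bounded_continuous (top_of_set S) (cone_sup l)"
proof -
  obtain M where "\<forall>x. cone_sup l x \<le> M" using cone_sup_bounded by blast
  then have "\<bar>cone_sup l x\<bar> \<le> M" for x using cone_sup_nonneg[of l x] by simp
  then show ?thesis
    by (auto simp: bounded_continuous_def continuous_on_cone_sup bounded_iff)
qed

lemma bounded_continuousD:
  assumes "bounded_continuous T f"
  shows "f \<in> borel_measurable (borel_of T)" "\<exists>M>0. \<forall>x\<in>topspace T. \<bar>f x\<bar> \<le> M"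
  using assms continuous_map_borel_measurable
  by (auto simp: bounded_continuous_def bounded_pos)

text \<open>A lower semicontinuous function is the supremum of the cones \<open>q - k * dist x c\<close> below it, where
  \<open>q\<close> is rational, \<open>k\<close> natural and \<open>c\<close> runs through a countable dense set. So countably many integrals
  \<open>\<integral>x. cone_sup l x \<partial>\<mu>\<close> determine the weak topology.\<close>

lemma lsc_approximation_by_cones:
  fixes f :: "'a::metric_space \<Rightarrow> real"
  assumes D: "countable D" "\<forall>V. open V \<longrightarrow> V \<noteq> {} \<longrightarrow> (\<exists>d\<in>D. d \<in> V)"
    and nonneg: "\<And>x. x \<in> S \<Longrightarrow> 0 \<le> f x"
    and lsc: "\<forall>x\<in>S. \<forall>e>0. \<exists>d>0. \<forall>y\<in>S. dist x y < d \<longrightarrow> f x - e < f y"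
  obtains L where "\<And>n. L n \<in> lists (\<rat> \<times> UNIV \<times> D)" "\<And>n x. x \<in> S \<Longrightarrow> cone_sup (L n) x \<le> f x"
    "\<And>x. x \<in> S \<Longrightarrow> (\<lambda>n. cone_sup (L n) x) \<longlonglongrightarrow> f x"
proof -
  define K where "K = {t \<in> \<rat> \<times> UNIV \<times> D. \<forall>x\<in>S. case t of (q, k, c) \<Rightarrow> q - real k * dist x c \<le> f x}"
  obtain d0 where d0: "d0 \<in> D" using D(2) by (metis UNIV_not_empty open_UNIV)
  \<comment> \<open>The zero cone lies below \<open>f\<close> because \<open>f\<close> is
    nonnegative. It makes \<open>K\<close> nonempty, so \<open>from_nat_into K\<close> enumerates
    members of \<open>K\<close> only, and it settles the points where
    \<open>f x < r\<close>.\<close>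
  then have K0: "(0, 0, d0) \<in> K" using nonneg by (auto simp: K_def)
  have Kc: "countable K" unfolding K_def
    by (rule countable_subset[of _ "\<rat> \<times> UNIV \<times> D"]) (auto simp: D(1) countable_rat)
  define L where "L n = map (from_nat_into K) [0..<n]" for n
  have LK: "set (L n) \<subseteq> K" for n
    using from_nat_into[of K] K0 unfolding L_def by (metis empty_iff image_subsetI set_map)
  have le: "cone_sup (L n) x \<le> f x" if "x \<in> S" for n x
    using LK[of n] that nonneg[OF that] by (fastforce simp: cone_sup_le_iff K_def)
  have lim: "(\<lambda>n. cone_sup (L n) x) \<longlonglongrightarrow> f x" if x: "x \<in> S" for x
  proof (rule LIMSEQ_I)
    fix r :: real assume r: "0 < r"
    \<comment> \<open>Three losses of size \<open>e\<close> occur: \<open>q\<close> lies within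
      \<open>2 * e\<close> of \<open>f x\<close>, and evaluating the cone at \<open>x\<close>
      instead of at its centre costs less than \<open>e\<close>. The total stays below
      \<open>r\<close>, and \<open>q\<close> is positive when \<open>f x \<ge> r\<close>.\<close>
    define e where "e = r / 4"
    have e: "e > 0" using r by (simp add: e_def)
    have "\<exists>t\<in>K. case t of (q, k, c) \<Rightarrow> f x - r < q - real k * dist x c"
    proof (cases "f x < r")
      case True then show ?thesis using K0 by (intro bexI[OF _ K0]) auto
    next
      case False
      obtain d where d: "d > 0" "\<And>y. y \<in> S \<Longrightarrow> dist x y < d \<Longrightarrow> f x - e < f y"
        using lsc x e by meson
      obtain q where q: "q \<in> \<rat>" "f x - 2 * e < q" "q < f x - e"
        using Rats_dense_in_real[of "f x - 2 * e" "f x - e"] e by auto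
      \<comment> \<open>The slope is so steep that the cone has fallen below 0 at distance
        \<open>d / 2\<close> from its centre. There it is below \<open>f\<close> by nonnegativity;
        closer to the centre its apex \<open>q\<close> is already below \<open>f\<close> by lower
        semicontinuity.\<close>
      obtain k :: nat where k: "q / (d / 2) < real k" using reals_Archimedean2 by blast
      then have k': "q < real k * (d / 2)" using d by (simp add: field_simps)
      have q0: "0 < q" using q False r e by (simp add: e_def)
      with k' have k0: "0 < real k" using d(1) by (cases k) auto
      \<comment> \<open>The centre may lie outside \<open>S\<close>, since the dense set is dense in
        the whole type. The radius \<open>d / 2\<close> keeps the relevant ball inside the
        \<open>d\<close>-ball around \<open>x\<close>, and \<open>e / real k\<close> bounds the loss
        at \<open>x\<close>.\<close>
      obtain c where c: "c \<in> D" "c \<in> ball x (min (d / 2) (e / real k))"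
        using D(2) open_ball[of x "min (d / 2) (e / real k)"] d(1) e k0
        by (metis centre_in_ball divide_pos_pos empty_iff half_gt_zero min_less_iff_conj)
      have "q - real k * dist y c \<le> f y" if y: "y \<in> S" for y
      proof (cases "dist y c < d / 2")
        case True
        then have "dist x y < d" using c dist_triangle2[of x y c] by (simp add: dist_commute)
        then have "f x - e < f y" using d y by blast
        moreover have "0 \<le> real k * dist y c" by simp
        ultimately show ?thesis using q by linarith
      next
        case False
        then have "real k * (d / 2) \<le> real k * dist y c" by (intro mult_left_mono) auto
        with k' nonneg[OF y] show ?thesis by linarith
      qed
      then have "(q, k, c) \<in> K" using q c by (auto simp: K_def)
      moreover have "real k * dist x c < e" using c k0 by (simp add: field_simps)
      then have "f x - r < q - real k * dist x c" using q e unfolding e_def by linarith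
      ultimately show ?thesis by auto
    qed
    then obtain q k c where t: "(q, k, c) \<in> K" "f x - r < q - real k * dist x c" by auto
    obtain i where i: "from_nat_into K i = (q, k, c)"
      using from_nat_into_surj[OF Kc t(1)] by auto
    have "norm (cone_sup (L n) x - f x) < r" if "n > i" for n
    proof -
      have "(q, k, c) \<in> set (L n)" using that i by (force simp: L_def)
      then have "q - real k * dist x c \<le> cone_sup (L n) x"
        using cone_sup_le_iff[of "L n" x "cone_sup (L n) x"] by fastforce
      then show ?thesis using le[OF x, of n] t(2) by simp
    qed
    then show "\<exists>no. \<forall>n\<ge>no. norm (cone_sup (L n) x - f x) < r"
      by (intro exI[of _ "Suc i"]) auto
  qed
  have "L n \<in> lists (\<rat> \<times> UNIV \<times> D)" for n using LK[of n] by (auto simp: K_def)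
  from that[OF this le lim] show thesis .
qed

text \<open>Bounded convergence applies because the approximants lie between 0 and
  \<open>f \<le> M\<close>. The point is that \<open>L\<close> is chosen before the measure: the
  inequality makes a lower bound on one cone integral a lower bound on the integral of
  \<open>f\<close> for all measures simultaneously, and the limit exhibits the integral of
  \<open>f\<close> as a pointwise limit of functions of the measure.\<close>

lemma cone_sup_integral_approximation:
  fixes f :: "'a::metric_space \<Rightarrow> real"
  assumes D: "countable D" "\<forall>V. open V \<longrightarrow> V \<noteq> {} \<longrightarrow> (\<exists>d\<in>D. d \<in> V)"
    and f: "f \<in> borel_measurable (borel_of (top_of_set S))" "\<And>x. x \<in> S \<Longrightarrow> 0 \<le> f x" "\<And>x. x \<in> S \<Longrightarrow> f x \<le> M"
    and lsc: "\<forall>x\<in>S. \<forall>e>0. \<exists>d>0. \<forall>y\<in>S. dist x y < d \<longrightarrow> f x - e < f y"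
  obtains L where "\<And>n. L n \<in> lists (\<rat> \<times> UNIV \<times> D)"
    "\<And>n \<mu>. \<mu> \<in> prob_measures (top_of_set S) \<Longrightarrow> (\<integral>x. cone_sup (L n) x \<partial>\<mu>) \<le> (\<integral>x. f x \<partial>\<mu>)"
    "\<And>\<mu>. \<mu> \<in> prob_measures (top_of_set S) \<Longrightarrow> (\<lambda>n. \<integral>x. cone_sup (L n) x \<partial>\<mu>) \<longlonglongrightarrow> (\<integral>x. f x \<partial>\<mu>)"
proof -
  obtain L where L: "\<And>n. L n \<in> lists (\<rat> \<times> UNIV \<times> D)" "\<And>n x. x \<in> S \<Longrightarrow> cone_sup (L n) x \<le> f x"
    "\<And>x. x \<in> S \<Longrightarrow> (\<lambda>n. cone_sup (L n) x) \<longlonglongrightarrow> f x"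
    using lsc_approximation_by_cones[OF D f(2) lsc] by blast
  have meas: "cone_sup (L n) \<in> borel_measurable (borel_of (top_of_set S))" for n
    by (rule bounded_continuousD(1)[OF bounded_continuous_cone_sup])
  have bnd: "\<bar>cone_sup (L n) x\<bar> \<le> M" if "x \<in> S" for n x
    using cone_sup_nonneg[of "L n" x] L(2)[OF that, of n] f(3)[OF that] by simp
  have "(\<integral>x. cone_sup (L n) x \<partial>\<mu>) \<le> (\<integral>x. f x \<partial>\<mu>)" if \<mu>: "\<mu> \<in> prob_measures (top_of_set S)" for n \<mu>
  proof (rule integral_mono)
    show "integrable \<mu> (cone_sup (L n))"
      by (rule prob_measures_integrable[OF \<mu> meas, where M = M]) (use bnd in auto)
    show "integrable \<mu> f"
      by (rule prob_measures_integrable[OF \<mu> f(1), where M = M]) (use f(2,3) in \<open>force simp: abs_le_iff\<close>)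
  qed (use L(2) prob_measuresD(2)[OF \<mu>] in auto)
  moreover have "(\<lambda>n. \<integral>x. cone_sup (L n) x \<partial>\<mu>) \<longlonglongrightarrow> (\<integral>x. f x \<partial>\<mu>)" if \<mu>: "\<mu> \<in> prob_measures (top_of_set S)" for \<mu>
    by (rule prob_measures_bounded_convergence[OF \<mu> meas, where M = M]) (use bnd L(3) in auto)
  ultimately show thesis using that L(1) by blast
qed

lemma continuous_lsc:
  fixes f :: "'a::metric_space \<Rightarrow> real"
  assumes "continuous_on S f"
  shows "\<forall>x\<in>S. \<forall>e>0. \<exists>d>0. \<forall>y\<in>S. dist x y < d \<longrightarrow> f x - e < f y"
proof (intro ballI allI impI)
  fix x and e :: real assume "x \<in> S" "0 < e"
  obtain d where "d > 0" "\<And>y. y \<in> S \<Longrightarrow> dist y x < d \<Longrightarrow> dist (f y) (f x) < e"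
    using assms \<open>x \<in> S\<close> \<open>0 < e\<close> unfolding continuous_on_iff by metis
  then show "\<exists>d>0. \<forall>y\<in>S. dist x y < d \<longrightarrow> f x - e < f y"
    by (intro exI[of _ d]) (force simp: dist_commute dist_real_def)
qed

text \<open>The base consists of finite intersections of sets given by strict rational lower bounds
  on cone integrals. Recording that its members also belong to \<open>prob_algebra\<close> makes it
  serve twice: for second countability and for comparing weakly open sets with the sigma-field of
  evaluations.\<close>

lemma weak_topology_countable_base:
  fixes S :: "'a::{metric_space, second_countable_topology} set"
  defines "W \<equiv> weak_topology (top_of_set S)"
  shows "\<exists>\<B>. countable \<B> \<and> (\<forall>V\<in>\<B>. openin W V \<and> V \<in> sets (prob_algebra (borel_of (top_of_set S)))) \<and>
    (\<forall>U \<mu>. openin W U \<and> \<mu> \<in> U \<longrightarrow> (\<exists>V\<in>\<B>. \<mu> \<in> V \<and> V \<subseteq> U))"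
proof -
  let ?PM = "prob_measures (top_of_set S)" and ?PA = "prob_algebra (borel_of (top_of_set S))"
  obtain D :: "'a set" where D: "countable D" "\<forall>V. open V \<longrightarrow> V \<noteq> {} \<longrightarrow> (\<exists>d\<in>D. d \<in> V)"
    using countable_dense_exists by blast
  define C where "C = (lists (\<rat> \<times> UNIV \<times> D) :: (real \<times> nat \<times> 'a) list set)"
  \<comment> \<open>Only lower bounds are imposed; upper bounds on the integral of \<open>f\<close>
    will come from lower bounds for \<open>M - f\<close>.\<close>
  define E where "E = (\<lambda>(l, q). {\<mu> \<in> ?PM. q < (\<integral>x. cone_sup l x \<partial>\<mu>)})"
  define \<E> where "\<E> = E ` (C \<times> \<rat>)"
  define \<B> where "\<B> = (\<lambda>F. ?PM \<inter> \<Inter>F) ` {F. finite F \<and> F \<subseteq> \<E>}"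
  have space: "space ?PA = ?PM" by (auto simp: space_prob_algebra prob_measures_def)
  have PMopen: "openin W ?PM" unfolding W_def by (metis openin_topspace topspace_weak_topology)
  have "countable \<E>" unfolding \<E>_def C_def using D(1)
    by (intro countable_image countable_SIGMA countable_lists) (auto simp: countable_rat)
  then have count: "countable \<B>" unfolding \<B>_def
    by (intro countable_image countable_Collect_finite_subset)
  have Eopen: "openin W V" "V \<in> sets ?PA" if V: "V \<in> \<E>" for V
  proof -
    obtain l q where lq: "V = {\<mu> \<in> ?PM. (\<integral>x. cone_sup l x \<partial>\<mu>) \<in> {q<..}}" using V by (auto simp: \<E>_def E_def)
    show "openin W V" unfolding W_def weak_topology_def lq
      by (intro topology_generated_by_Basis) (use bounded_continuous_cone_sup open_greaterThan in blast)
    have "cone_sup l \<in> borel_measurable (borel_of (top_of_set S))"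
      by (rule bounded_continuousD(1)[OF bounded_continuous_cone_sup])
    then have "(\<lambda>\<mu>. \<integral>x. cone_sup l x \<partial>\<mu>) \<in> borel_measurable ?PA"
      unfolding prob_algebra_def by (intro measurable_restrict_space1 integral_measurable_subprob_algebra)
    then have "(\<lambda>\<mu>. \<integral>x. cone_sup l x \<partial>\<mu>) -` {q<..} \<inter> space ?PA \<in> sets ?PA" by (rule measurable_sets) simp
    also have "(\<lambda>\<mu>. \<integral>x. cone_sup l x \<partial>\<mu>) -` {q<..} \<inter> space ?PA = V" unfolding space lq by auto
    finally show "V \<in> sets ?PA" .
  qed
  have Bopen: "openin W V \<and> V \<in> sets ?PA" if V: "V \<in> \<B>" for V
  proof -
    obtain F where F: "finite F" "F \<subseteq> \<E>" "V = ?PM \<inter> \<Inter>F" using V unfolding \<B>_def by auto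
    from F(1,2) have "openin W (?PM \<inter> \<Inter>F) \<and> ?PM \<inter> \<Inter>F \<in> sets ?PA"
    proof (induction F)
      case empty show ?case using PMopen sets.top[of ?PA] by (simp add: space)
    next
      case (insert U F)
      then have "openin W (U \<inter> (?PM \<inter> \<Inter>F)) \<and> U \<inter> (?PM \<inter> \<Inter>F) \<in> sets ?PA"
        using Eopen[of U] by auto
      also have "U \<inter> (?PM \<inter> \<Inter>F) = ?PM \<inter> \<Inter>(insert U F)" by auto
      finally show ?case .
    qed
    then show ?thesis using F(3) by simp
  qed
  have BInt: "V \<inter> V' \<in> \<B>" if "V \<in> \<B>" "V' \<in> \<B>" for V V'
  proof -
    obtain F F' where "finite F" "F \<subseteq> \<E>" "V = ?PM \<inter> \<Inter>F" "finite F'" "F' \<subseteq> \<E>" "V' = ?PM \<inter> \<Inter>F'"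
      using \<open>V \<in> \<B>\<close> \<open>V' \<in> \<B>\<close> unfolding \<B>_def by auto
    then show ?thesis unfolding \<B>_def by (intro image_eqI[of _ _ "F \<union> F'"]) auto
  qed
  have EB: "?PM \<inter> V \<in> \<B>" if "V \<in> \<E>" for V
    using that unfolding \<B>_def by (intro image_eqI[of _ _ "{V}"]) auto
  \<comment> \<open>A strict lower bound for the integral of \<open>g\<close> at one measure is
    already witnessed by a single cone integral exceeding a rational above \<open>r\<close>. Since
    the cone function lies below \<open>g\<close>, the bound persists on the whole base set.\<close>
  have lower: "\<exists>V\<in>\<B>. \<mu> \<in> V \<and> (\<forall>\<nu>\<in>V. \<nu> \<in> ?PM \<and> r < (\<integral>x. g x \<partial>\<nu>))"
    if g: "continuous_on S g" "\<And>x. x \<in> S \<Longrightarrow> 0 \<le> g x" "\<And>x. x \<in> S \<Longrightarrow> g x \<le> M"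
      and \<mu>: "\<mu> \<in> ?PM" and r: "r < (\<integral>x. g x \<partial>\<mu>)" for g :: "'a \<Rightarrow> real" and M r \<mu>
  proof -
    have gm: "g \<in> borel_measurable (borel_of (top_of_set S))"
      using g(1) by (intro continuous_map_borel_measurable) simp
    obtain L where L: "\<And>n. L n \<in> lists (\<rat> \<times> UNIV \<times> D)"
      "\<And>n \<mu>. \<mu> \<in> ?PM \<Longrightarrow> (\<integral>x. cone_sup (L n) x \<partial>\<mu>) \<le> (\<integral>x. g x \<partial>\<mu>)"
      "\<And>\<mu>. \<mu> \<in> ?PM \<Longrightarrow> (\<lambda>n. \<integral>x. cone_sup (L n) x \<partial>\<mu>) \<longlonglongrightarrow> (\<integral>x. g x \<partial>\<mu>)"
      using cone_sup_integral_approximation[OF D gm g(2,3) continuous_lsc[OF g(1)]] by blast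
    have "\<forall>\<^sub>F n in sequentially. r < (\<integral>x. cone_sup (L n) x \<partial>\<mu>)"
      using L(3)[OF \<mu>] r by (rule order_tendstoD(1))
    then obtain n where n: "r < (\<integral>x. cone_sup (L n) x \<partial>\<mu>)"
      by (auto simp: eventually_sequentially)
    obtain q where q: "q \<in> \<rat>" "r < q" "q < (\<integral>x. cone_sup (L n) x \<partial>\<mu>)"
      using Rats_dense_in_real[OF n] by auto
    have "E (L n, q) \<in> \<E>" using L(1) q(1) by (auto simp: \<E>_def C_def)
    from EB[OF this] show ?thesis
      using q \<mu> L(2)[of _ n] by (intro bexI[of _ "?PM \<inter> E (L n, q)"]) (fastforce simp: E_def)+
  qed
  have local: "\<exists>V\<in>\<B>. \<mu> \<in> V \<and> V \<subseteq> {\<mu> \<in> ?PM. (\<integral>x. f x \<partial>\<mu>) \<in> U}"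
    if f: "bounded_continuous (top_of_set S) f" and U: "open U" and \<mu>: "\<mu> \<in> ?PM" "(\<integral>x. f x \<partial>\<mu>) \<in> U" for f U \<mu>
  proof -
    obtain M where M: "\<And>x. x \<in> S \<Longrightarrow> \<bar>f x\<bar> \<le> M" using bounded_continuousD(2)[OF f] by auto
    have cont: "continuous_on S f" using f by (simp add: bounded_continuous_def)
    have int: "(\<integral>x. f x + M \<partial>\<nu>) = (\<integral>x. f x \<partial>\<nu>) + M" "(\<integral>x. M - f x \<partial>\<nu>) = M - (\<integral>x. f x \<partial>\<nu>)"
      if \<nu>: "\<nu> \<in> ?PM" for \<nu>
    proof -
      interpret prob_space \<nu> using prob_measuresD(3)[OF \<nu>] .
      have "integrable \<nu> f"
        by (rule prob_measures_integrable[OF \<nu> bounded_continuousD(1)[OF f], where M = M]) (use M in auto)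
      then show "(\<integral>x. f x + M \<partial>\<nu>) = (\<integral>x. f x \<partial>\<nu>) + M" "(\<integral>x. M - f x \<partial>\<nu>) = M - (\<integral>x. f x \<partial>\<nu>)"
        by (simp_all add: prob_space)
    qed
    obtain e where e: "e > 0" "\<And>t. \<bar>t - (\<integral>x. f x \<partial>\<mu>)\<bar> < e \<Longrightarrow> t \<in> U"
      using U \<mu>(2) unfolding open_dist dist_real_def by blast
    \<comment> \<open>The shifts \<open>f + M\<close> and \<open>M - f\<close> both take values
      between 0 and \<open>2 * M\<close>. Their lower bounds on \<open>V\<close> and on
      \<open>V'\<close> confine the integral of \<open>f\<close> to within \<open>e\<close> from
      below and from above.\<close>
    have "\<exists>V\<in>\<B>. \<mu> \<in> V \<and> (\<forall>\<nu>\<in>V. \<nu> \<in> ?PM \<and> (\<integral>x. f x + M \<partial>\<mu>) - e < (\<integral>x. f x + M \<partial>\<nu>))"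
    proof (rule lower[where M = "2 * M"])
      fix x assume "x \<in> S"
      from M[OF this] show "0 \<le> f x + M" "f x + M \<le> 2 * M" by auto
    qed (use cont \<mu> e in \<open>auto intro!: continuous_intros\<close>)
    then obtain V where V: "V \<in> \<B>" "\<mu> \<in> V"
      "\<And>\<nu>. \<nu> \<in> V \<Longrightarrow> \<nu> \<in> ?PM \<and> (\<integral>x. f x + M \<partial>\<mu>) - e < (\<integral>x. f x + M \<partial>\<nu>)" by blast
    have "\<exists>V\<in>\<B>. \<mu> \<in> V \<and> (\<forall>\<nu>\<in>V. \<nu> \<in> ?PM \<and> (\<integral>x. M - f x \<partial>\<mu>) - e < (\<integral>x. M - f x \<partial>\<nu>))"
    proof (rule lower[where M = "2 * M"])
      fix x assume "x \<in> S"
      from M[OF this] show "0 \<le> M - f x" "M - f x \<le> 2 * M" by auto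
    qed (use cont \<mu> e in \<open>auto intro!: continuous_intros\<close>)
    then obtain V' where V': "V' \<in> \<B>" "\<mu> \<in> V'"
      "\<And>\<nu>. \<nu> \<in> V' \<Longrightarrow> \<nu> \<in> ?PM \<and> (\<integral>x. M - f x \<partial>\<mu>) - e < (\<integral>x. M - f x \<partial>\<nu>)" by blast
    have "\<nu> \<in> ?PM \<and> (\<integral>x. f x \<partial>\<nu>) \<in> U" if \<nu>: "\<nu> \<in> V \<inter> V'" for \<nu>
    proof -
      have "\<nu> \<in> ?PM" using \<nu> V(3) by blast
      moreover have "\<bar>(\<integral>x. f x \<partial>\<nu>) - (\<integral>x. f x \<partial>\<mu>)\<bar> < e"
        using V(3)[of \<nu>] V'(3)[of \<nu>] \<nu> int[OF \<mu>(1)] int[of \<nu>] by (auto simp: abs_less_iff)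
      ultimately show ?thesis using e(2) by blast
    qed
    then show ?thesis using V(2) V'(2) by (intro bexI[OF _ BInt[OF V(1) V'(1)]]) auto
  qed
  have base: "\<exists>V\<in>\<B>. \<mu> \<in> V \<and> V \<subseteq> U" if U: "openin W U" and \<mu>: "\<mu> \<in> U" for U \<mu>
  proof -
    have "generate_topology_on {{\<mu> \<in> ?PM. (\<integral>x. f x \<partial>\<mu>) \<in> U} | f U. bounded_continuous (top_of_set S) f \<and> open U} U"
      using U unfolding W_def weak_topology_def by (rule openin_topology_generated_by)
    from this \<mu> show ?thesis
    proof (induction arbitrary: \<mu> rule: generate_topology_on.induct)
      case (Int a b)
      obtain V V' where "V \<in> \<B>" "\<mu> \<in> V" "V \<subseteq> a" "V' \<in> \<B>" "\<mu> \<in> V'" "V' \<subseteq> b"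
        using Int.IH[of \<mu>] Int.prems by auto
      then show ?case using BInt by (intro bexI[of _ "V \<inter> V'"]) auto
    next
      case (UN K)
      then show ?case by (meson Union_iff Union_upper order_trans)
    next
      case (Basis s)
      then show ?case using local by blast
    qed auto
  qed
  show ?thesis
    by (intro exI[of _ \<B>] conjI) (use count Bopen base in auto)
qed

section \<open>Weak Borel sets and the sigma-field of evaluations\<close>

lemma continuous_map_weak_topology_integral:
  assumes "bounded_continuous T f"
  shows "continuous_map (weak_topology T) euclideanreal (\<lambda>\<mu>. \<integral>x. f x \<partial>\<mu>)"
proof -
  have "openin (weak_topology T) {\<mu> \<in> prob_measures T. (\<integral>x. f x \<partial>\<mu>) \<in> U}" if "open U" for U
    unfolding weak_topology_def
    by (intro topology_generated_by_Basis CollectI exI[of _ f] exI[of _ U] conjI refl assms that)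
  then show ?thesis by (simp add: continuous_map_def)
qed

lemma second_countable_weak_topology:
  "second_countable (weak_topology (top_of_set (S :: 'a::{metric_space, second_countable_topology} set)))"
  using weak_topology_countable_base[of S] unfolding second_countable_def by meson

text \<open>A weakly open set is a countable union of base members lying in
  \<open>prob_algebra\<close>. This is the inclusion of the weak Borel sets in the evaluation
  sigma-field, and it lets \<open>H\<close> be used as a measurable map into the weak Borel
  space.\<close>

lemma prob_algebra_measurable_weak_topology:
  fixes S :: "'a::{metric_space, second_countable_topology} set"
  assumes f: "f \<in> M \<rightarrow>\<^sub>M prob_algebra (borel_of (top_of_set S))"
  shows "f \<in> M \<rightarrow>\<^sub>M borel_of (weak_topology (top_of_set S))"
proof (rule measurable_borel_ofI)
  fix U assume U: "openin (weak_topology (top_of_set S)) U"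
  obtain \<B> where B: "countable \<B>" "\<forall>V\<in>\<B>. openin (weak_topology (top_of_set S)) V \<and> V \<in> sets (prob_algebra (borel_of (top_of_set S)))"
    "\<forall>U \<mu>. openin (weak_topology (top_of_set S)) U \<and> \<mu> \<in> U \<longrightarrow> (\<exists>V\<in>\<B>. \<mu> \<in> V \<and> V \<subseteq> U)"
    using weak_topology_countable_base[of S] by (elim exE conjE)
  have "U = \<Union>{V \<in> \<B>. V \<subseteq> U}" using B(3) U by blast
  also have "\<dots> \<in> sets (prob_algebra (borel_of (top_of_set S)))"
    using B(1,2) by (intro sets.countable_Union) (auto intro: countable_subset[of _ \<B>])
  finally show "f -` U \<inter> space M \<in> sets M" by (rule measurable_sets[OF f])
qed (use measurable_space[OF f] in \<open>auto simp: space_prob_algebra prob_measures_def\<close>)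

text \<open>The converse inclusion. The indicator of an open set is lower semicontinuous, so its
  evaluation is a pointwise limit of cone integrals, which are weakly continuous in the measure.
  Open sets form a generating pi-system, which extends this to all Borel sets.\<close>

lemma measurable_prob_algebra_borel_of_weak:
  fixes S :: "'a::{metric_space, second_countable_topology} set"
  shows "(\<lambda>\<mu>. \<mu>) \<in> borel_of (weak_topology (top_of_set S)) \<rightarrow>\<^sub>M prob_algebra (borel_of (top_of_set S))"
proof (rule measurable_prob_algebra_generated[where \<Omega> = S and G = "{U. openin (top_of_set S) U}"])
  let ?W = "weak_topology (top_of_set S)"
  show "sets (borel_of (top_of_set S)) = sigma_sets S {U. openin (top_of_set S) U}"
    by (simp add: sets_borel_of)
  show "Int_stable {U. openin (top_of_set S) U}" by (auto simp: Int_stable_def)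
  show "{U. openin (top_of_set S) U} \<subseteq> Pow S" by (auto dest: openin_imp_subset)
  fix U assume "U \<in> {U. openin (top_of_set S) U}"
  then have U: "openin (top_of_set S) U" by simp
  obtain D :: "'a set" where D: "countable D" "\<forall>V. open V \<longrightarrow> V \<noteq> {} \<longrightarrow> (\<exists>d\<in>D. d \<in> V)"
    using countable_dense_exists by blast
  have "\<exists>d>0. \<forall>y\<in>S. dist x y < d \<longrightarrow> indicat_real U x - e < indicat_real U y" if x: "x \<in> S" "0 < e" for x e
  proof (cases "x \<in> U")
    case True
    then obtain d where "d > 0" "\<forall>y\<in>S. dist y x < d \<longrightarrow> y \<in> U"
      using U unfolding openin_euclidean_subtopology_iff by blast
    then show ?thesis using x True by (intro exI[of _ d]) (auto simp: dist_commute)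
  qed (use x in \<open>auto intro!: exI[of _ 1] simp: indicator_def\<close>)
  then have lsc: "\<forall>x\<in>S. \<forall>e>0. \<exists>d>0. \<forall>y\<in>S. dist x y < d \<longrightarrow> indicat_real U x - e < indicat_real U y"
    by blast
  have U_meas: "indicat_real U \<in> borel_measurable (borel_of (top_of_set S))"
    using openin_borel_of[OF U] by simp
  obtain L where L: "\<And>\<mu>. \<mu> \<in> prob_measures (top_of_set S) \<Longrightarrow>
      (\<lambda>n. \<integral>x. cone_sup (L n) x \<partial>\<mu>) \<longlonglongrightarrow> (\<integral>x. indicat_real U x \<partial>\<mu>)"
    by (rule cone_sup_integral_approximation[OF D U_meas indicator_pos_le indicator_le_1 lsc]) (rule that)
  have m: "(\<lambda>\<mu>. \<integral>x. cone_sup (L n) x \<partial>\<mu>) \<in> borel_measurable (borel_of ?W)" for n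
    by (intro continuous_map_borel_measurable continuous_map_weak_topology_integral bounded_continuous_cone_sup)
  have "(\<lambda>\<mu>. \<integral>x. indicat_real U x \<partial>\<mu>) \<in> borel_measurable (borel_of ?W)"
    by (rule borel_measurable_LIMSEQ_metric[OF m]) (use L in simp)
  then have "(\<lambda>\<mu>. ennreal (\<integral>x. indicat_real U x \<partial>\<mu>)) \<in> borel_measurable (borel_of ?W)" by simp
  also have "?this \<longleftrightarrow> (\<lambda>\<mu>. emeasure \<mu> U) \<in> borel_measurable (borel_of ?W)"
  proof (rule measurable_cong)
    fix \<mu> assume "\<mu> \<in> space (borel_of ?W)"
    then have \<mu>: "\<mu> \<in> prob_measures (top_of_set S)" by simp
    interpret prob_space \<mu> using prob_measuresD(3)[OF \<mu>] .
    show "ennreal (\<integral>x. indicat_real U x \<partial>\<mu>) = emeasure \<mu> U"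
      using openin_borel_of[OF U] prob_measuresD(1)[OF \<mu>] by (simp add: emeasure_eq_measure)
  qed
  finally show "(\<lambda>\<mu>. emeasure \<mu> U) \<in> borel_measurable (borel_of ?W)" .
qed (auto simp: prob_measures_def)

section \<open>Integrals of converging functions against converging measures\<close>

text \<open>An Egorov-type argument: outside a set of small \<open>\<mu>\<close>-measure all late
  integrands are within \<open>e\<close> of the limit, and setwise convergence carries the smallness
  of this one set over to \<open>\<mu>s n\<close>.\<close>

lemma setwise_convergence_integral:
  fixes \<phi> :: "nat \<Rightarrow> 'a \<Rightarrow> real"
  assumes \<mu>s: "\<And>n. \<mu>s n \<in> prob_measures T" and \<mu>: "\<mu> \<in> prob_measures T"
    and conv: "converges_setwise T \<mu>s \<mu>"
    and meas: "\<And>n. \<phi> n \<in> borel_measurable (borel_of T)" "\<psi> \<in> borel_measurable (borel_of T)"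
    and bound: "\<And>n x. x \<in> topspace T \<Longrightarrow> \<bar>\<phi> n x\<bar> \<le> M" "\<And>x. x \<in> topspace T \<Longrightarrow> \<bar>\<psi> x\<bar> \<le> M"
    and lim: "AE x in \<mu>. (\<lambda>n. \<phi> n x) \<longlonglongrightarrow> \<psi> x"
  shows "(\<lambda>n. \<integral>x. \<phi> n x \<partial>\<mu>s n) \<longlonglongrightarrow> (\<integral>x. \<psi> x \<partial>\<mu>)"
proof (rule LIMSEQ_I)
  fix r :: real assume r: "r > 0"
  interpret \<mu>: prob_space \<mu> using prob_measuresD(3)[OF \<mu>] .
  obtain x0 where "x0 \<in> topspace T" using \<mu>.not_empty prob_measuresD(2)[OF \<mu>] by blast
  from bound(2)[OF this] have M: "M \<ge> 0" by simp
  \<comment> \<open>The errors are \<open>e\<close> off the exceptional set,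
    \<open>2 * M * e\<close> on it, and \<open>e\<close> for replacing \<open>\<mu>s n\<close> by
    \<open>\<mu>\<close> under \<open>\<psi>\<close>. Their sum is strictly below
    \<open>e * (3 + 2 * M) = r\<close>.\<close>
  define e where "e = r / (3 + 2 * M)"
  have e: "e > 0" using r M by (simp add: e_def)
  \<comment> \<open>The existential over the tail makes the set independent of \<open>n\<close>.
    Almost every point leaves it as \<open>N\<close> grows, so its \<open>\<mu>\<close>-measure
    tends to 0.\<close>
  define B where "B N = {x \<in> topspace T. \<exists>n\<ge>N. e < \<bar>\<phi> n x - \<psi> x\<bar>}" for N
  have Bm: "B N \<in> sets (borel_of T)" for N
  proof -
    have "{x \<in> space (borel_of T). \<exists>n\<in>{N..}. e < \<bar>\<phi> n x - \<psi> x\<bar>} \<in> sets (borel_of T)"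
      using meas by measurable
    also have "{x \<in> space (borel_of T). \<exists>n\<in>{N..}. e < \<bar>\<phi> n x - \<psi> x\<bar>} = B N"
      by (auto simp: B_def)
    finally show ?thesis .
  qed
  then have Bb: "indicat_real (B N) \<in> borel_measurable (borel_of T)" for N by simp
  have bborel: "bounded_borel T (indicat_real (B N))" "bounded_borel T \<psi>" for N
    using Bb meas(2) bound(2)
    by (auto simp: bounded_borel_def bounded_iff simp del: indicator_simps intro: exI[of _ "1::real"] exI[of _ M])
  have "AE x in \<mu>. (\<lambda>N. indicat_real (B N) x) \<longlonglongrightarrow> 0"
    using lim
  proof eventually_elim
    case (elim x)
    obtain N where N: "\<And>n. n \<ge> N \<Longrightarrow> \<bar>\<phi> n x - \<psi> x\<bar> < e"
      using LIMSEQ_D[OF elim e] by auto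
    have "x \<notin> B m" if "m \<ge> N" for m
      using N order_trans[OF that] by (force simp: B_def not_less)
    then have "indicat_real (B m) x = 0" if "m \<ge> N" for m using that by simp
    then show ?case by (intro tendsto_eventually) (auto simp: eventually_sequentially)
  qed
  then have "(\<lambda>N. \<integral>x. indicat_real (B N) x \<partial>\<mu>) \<longlonglongrightarrow> (\<integral>x. 0 \<partial>\<mu>)"
    using prob_measures_measurable[OF \<mu> Bb]
    by (intro integral_dominated_convergence[where w = "\<lambda>_. 1"]) auto
  then obtain N where N: "(\<integral>x. indicat_real (B N) x \<partial>\<mu>) < e"
    using order_tendstoD(2)[of _ 0 sequentially e] e by (auto simp: eventually_sequentially)
  have ev1: "\<forall>\<^sub>F n in sequentially. (\<integral>x. indicat_real (B N) x \<partial>\<mu>s n) < e"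
    by (rule order_tendstoD(2)[OF conv[unfolded converges_setwise_def, rule_format, OF bborel(1)] N])
  have "(\<lambda>n. \<integral>x. \<psi> x \<partial>\<mu>s n) \<longlonglongrightarrow> (\<integral>x. \<psi> x \<partial>\<mu>)"
    by (rule conv[unfolded converges_setwise_def, rule_format, OF bborel(2)])
  then have ev2: "\<forall>\<^sub>F n in sequentially. dist (\<integral>x. \<psi> x \<partial>\<mu>s n) (\<integral>x. \<psi> x \<partial>\<mu>) < e"
    using e by (rule tendstoD)
  have "\<forall>\<^sub>F n in sequentially. norm ((\<integral>x. \<phi> n x \<partial>\<mu>s n) - (\<integral>x. \<psi> x \<partial>\<mu>)) < r"
    using ev1 ev2 eventually_ge_at_top[of N]
  proof eventually_elim
    case (elim n)
    interpret prob_space "\<mu>s n" using prob_measuresD(3)[OF \<mu>s] .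
    have i: "integrable (\<mu>s n) (\<phi> n)" "integrable (\<mu>s n) \<psi>" "integrable (\<mu>s n) (indicat_real (B N))"
      using meas bound Bb by (auto intro: prob_measures_integrable[OF \<mu>s, where M = M]
          prob_measures_integrable[OF \<mu>s, where M = 1] simp del: indicator_simps)
    \<comment> \<open>Off \<open>B N\<close> the deviation is at most \<open>e\<close>, because
      \<open>n \<ge> N\<close>; on it the trivial bound \<open>2 * M\<close> is used.\<close>
    have "\<bar>\<phi> n x - \<psi> x\<bar> \<le> e + 2 * M * indicat_real (B N) x" if "x \<in> space (\<mu>s n)" for x
    proof -
      have x: "x \<in> topspace T" using that prob_measuresD(2)[OF \<mu>s] by simp
      show ?thesis
        using bound(1)[OF x, of n] bound(2)[OF x] e elim(3) x
        by (cases "x \<in> B N") (auto simp: B_def not_less)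
    qed
    then have "(\<integral>x. \<bar>\<phi> n x - \<psi> x\<bar> \<partial>\<mu>s n) \<le> (\<integral>x. e + 2 * M * indicat_real (B N) x \<partial>\<mu>s n)"
      using i by (intro integral_mono) auto
    also have "\<dots> = e + 2 * M * (\<integral>x. indicat_real (B N) x \<partial>\<mu>s n)"
      using i by (simp add: prob_space)
    also have "\<dots> \<le> e + 2 * M * e"
      using elim(1) M by (intro add_left_mono mult_left_mono) auto
    finally have "\<bar>\<integral>x. \<phi> n x - \<psi> x \<partial>\<mu>s n\<bar> \<le> e + 2 * M * e"
      using integral_abs_bound[of "\<mu>s n" "\<lambda>x. \<phi> n x - \<psi> x"] by linarith
    then have "\<bar>(\<integral>x. \<phi> n x \<partial>\<mu>s n) - (\<integral>x. \<psi> x \<partial>\<mu>s n)\<bar> \<le> e + 2 * M * e"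
      using i by simp
    with elim(2) have "\<bar>(\<integral>x. \<phi> n x \<partial>\<mu>s n) - (\<integral>x. \<psi> x \<partial>\<mu>)\<bar> < 2 * e + 2 * M * e"
      by (simp add: dist_real_def)
    also have "\<dots> < e * (3 + 2 * M)" using e by (simp add: algebra_simps)
    also have "\<dots> = r" using M by (simp add: e_def)
    finally show ?case by simp
  qed
  then show "\<exists>no. \<forall>n\<ge>no. norm ((\<integral>x. \<phi> n x \<partial>\<mu>s n) - (\<integral>x. \<psi> x \<partial>\<mu>)) < r"
    by (simp add: eventually_sequentially)
qed

section \<open>Continuously converging integrands against weakly convergent measures\<close>

text \<open>Continuous convergence in the sense of Hahn, stated along arbitrary index maps
  \<open>r\<close> tending to infinity. With \<open>r\<close> built in, the notion passes to
  subsequences at once, and a contradiction argument may pick indices without arranging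
  monotonicity.\<close>

definition continuously_converges :: "'a::topological_space set \<Rightarrow> (nat \<Rightarrow> 'a \<Rightarrow> real) \<Rightarrow> ('a \<Rightarrow> real) \<Rightarrow> bool" where
  "continuously_converges S G g \<longleftrightarrow>
     (\<forall>r ys y. filterlim r sequentially sequentially \<and> (\<forall>k. ys k \<in> S) \<and> y \<in> S \<and> ys \<longlonglongrightarrow> y \<longrightarrow>
        (\<lambda>k. G (r k) (ys k)) \<longlonglongrightarrow> g y)"

lemma continuously_convergesI:
  assumes "\<And>r ys y. filterlim r sequentially sequentially \<Longrightarrow> (\<And>k. ys k \<in> S) \<Longrightarrow> y \<in> S \<Longrightarrow> ys \<longlonglongrightarrow> y \<Longrightarrow>
    (\<lambda>k. G (r k) (ys k)) \<longlonglongrightarrow> g y"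
  shows "continuously_converges S G g"
  unfolding continuously_converges_def by (intro allI impI, elim conjE) (rule assms, auto)

lemma continuously_convergesD:
  assumes "continuously_converges S G g" "filterlim r sequentially sequentially"
    "\<And>k. ys k \<in> S" "y \<in> S" "ys \<longlonglongrightarrow> y"
  shows "(\<lambda>k. G (r k) (ys k)) \<longlonglongrightarrow> g y"
  using assms(1)[unfolded continuously_converges_def, rule_format, of r ys y] assms(2-5) by simp

lemma continuously_converges_uminus:
  assumes "continuously_converges S G g"
  shows "continuously_converges S (\<lambda>n x. - G n x) (\<lambda>x. - g x)"
  by (intro continuously_convergesI tendsto_minus) (rule continuously_convergesD[OF assms])

lemma continuously_converges_subseq:
  assumes "continuously_converges S G g" "filterlim r sequentially sequentially"
  shows "continuously_converges S (\<lambda>k. G (r k)) g"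
  by (rule continuously_convergesI)
    (rule continuously_convergesD[OF assms(1) filterlim_compose[OF assms(2)]])

text \<open>If no neighbourhood and no tail work, each \<open>k\<close> yields an index at least
  \<open>k\<close> and a point within \<open>1 / (k + 1)\<close> of \<open>y\<close> that violate
  the bound. Along these indices and points continuous convergence would force
  \<open>g y \<le> g y - e\<close>.\<close>

lemma continuously_converges_eventually_ge:
  fixes S :: "'a::metric_space set"
  assumes cc: "continuously_converges S G g" and y: "y \<in> S" and e: "0 < e"
  shows "\<exists>d>0. \<exists>N. \<forall>n\<ge>N. \<forall>x\<in>S. dist x y < d \<longrightarrow> g y - e < G n x"
proof (rule ccontr)
  assume neg: "\<not> ?thesis"
  have "\<exists>n x. n \<ge> k \<and> x \<in> S \<and> dist x y < inverse (real (Suc k)) \<and> G n x \<le> g y - e" for k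
  proof (rule ccontr)
    assume "\<not> ?thesis"
    then have "\<forall>n\<ge>k. \<forall>x\<in>S. dist x y < inverse (real (Suc k)) \<longrightarrow> g y - e < G n x"
      by (metis not_le)
    moreover have "0 < inverse (real (Suc k))" by simp
    ultimately show False using neg by blast
  qed
  then obtain r ys where *: "\<And>k. r k \<ge> k" "\<And>k. ys k \<in> S" "\<And>k. dist (ys k) y < inverse (real (Suc k))"
    "\<And>k. G (r k) (ys k) \<le> g y - e" by metis
  have r: "filterlim r sequentially sequentially"
    by (rule filterlim_at_top_mono[OF filterlim_ident]) (use *(1) in auto)
  have "(\<lambda>k. dist (ys k) y) \<longlonglongrightarrow> 0"
    by (rule tendsto_sandwich[OF _ _ tendsto_const LIMSEQ_inverse_real_of_nat])
      (use *(3) in \<open>auto intro!: always_eventually less_imp_le\<close>)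
  then have "ys \<longlonglongrightarrow> y" by (rule tendsto_dist_iff[THEN iffD2])
  from continuously_convergesD[where G = G and r = r, OF cc r *(2) y this]
  have "g y \<le> g y - e" by (rule LIMSEQ_le_const2) (use *(4) in auto)
  with e show False by simp
qed

text \<open>The minorant \<open>\<lambda>y. INF n \<ge> N, y'. G n y' + N * dist y y'\<close> is Lipschitz and lies below every
  \<open>G n\<close> with \<open>n \<ge> N\<close>, and it tends to \<open>g\<close> as \<open>N\<close> grows.\<close>

lemma weak_convergence_integral_lower:
  fixes S :: "'a::metric_space set"
  assumes \<mu>s: "\<And>n. \<mu>s n \<in> prob_measures (top_of_set S)" and \<mu>: "\<mu> \<in> prob_measures (top_of_set S)"
    and conv: "converges_weakly (top_of_set S) \<mu>s \<mu>"
    and meas: "\<And>n. G n \<in> borel_measurable (borel_of (top_of_set S))"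
    and bound: "\<And>n x. x \<in> S \<Longrightarrow> \<bar>G n x\<bar> \<le> M"
    and cc: "continuously_converges S G g" and e: "0 < e"
  shows "\<forall>\<^sub>F n in sequentially. (\<integral>x. g x \<partial>\<mu>) - e < (\<integral>x. G n x \<partial>\<mu>s n)"
proof -
  define I where "I N = {N..} \<times> S" for N :: nat
  define h where "h N y = (INF p\<in>I N. G (fst p) (snd p) + real N * dist y (snd p))" for N y
  have lowp: "- M \<le> G (fst p) (snd p) + real N * dist y (snd p)" if "p \<in> I N'" for N N' p y
  proof -
    have "- M \<le> G (fst p) (snd p)" using bound[of "snd p" "fst p"] that by (auto simp: I_def abs_le_iff)
    moreover have "0 \<le> real N * dist y (snd p)" by simp
    ultimately show ?thesis by linarith
  qed
  \<comment> \<open>The uniform bound \<open>- M\<close> makes the family bounded below, without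
    which \<open>INF\<close> over the reals carries no information.\<close>
  then have bdd: "bdd_below ((\<lambda>p. G (fst p) (snd p) + real N * dist y (snd p)) ` I N)" for N y
    by (intro bdd_belowI2[of _ "- M"])
  have h_le: "h N y \<le> G n x + real N * dist y x" if "n \<ge> N" "x \<in> S" for N y n x
    unfolding h_def using cINF_lower[OF bdd, of "(n, x)" N y] that by (simp add: I_def)
  have h_leG: "h N x \<le> G n x" if "n \<ge> N" "x \<in> S" for N n x
    using h_le[OF that, of x] by simp
  have h_ge: "c \<le> h N y" if "y \<in> S" "\<And>n x. n \<ge> N \<Longrightarrow> x \<in> S \<Longrightarrow> c \<le> G n x + real N * dist y x" for N y c
    unfolding h_def by (rule cINF_greatest) (use that in \<open>auto simp: I_def\<close>)
  have h_bound: "\<bar>h N y\<bar> \<le> M" if y: "y \<in> S" for N y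
  proof -
    have "- M \<le> h N y" by (rule h_ge[OF y]) (use lowp[of "(_, _)" N N] in \<open>auto simp: I_def\<close>)
    moreover have "h N y \<le> M" using h_leG[OF order_refl y, of N] bound[OF y, of N] by linarith
    ultimately show ?thesis by simp
  qed
  have Lip: "h N y \<le> h N z + real N * dist y z" if "y \<in> S" "z \<in> S" for N y z
  proof -
    have "h N y - real N * dist y z \<le> h N z"
    proof (rule h_ge[OF that(2)])
      fix n x assume nx: "n \<ge> N" "x \<in> S"
      have "real N * dist y x \<le> real N * dist y z + real N * dist z x"
        using mult_left_mono[OF dist_triangle[of y x z], of "real N"] by (simp add: algebra_simps)
      with h_le[OF nx, of y] show "h N y - real N * dist y z \<le> G n x + real N * dist z x" by linarith
    qed
    then show ?thesis by linarith
  qed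
  have "(real N)-lipschitz_on S (h N)" for N
    by (rule lipschitz_onI) (use Lip[of _ _ N] in \<open>force simp: dist_real_def abs_le_iff dist_commute\<close>)+
  then have "continuous_on S (h N)" for N by (rule lipschitz_on_continuous_on)
  then have hbc: "bounded_continuous (top_of_set S) (h N)" for N
    using h_bound by (auto simp: bounded_continuous_def bounded_iff)
  have g_bound: "\<bar>g y\<bar> \<le> M" and G_lim: "(\<lambda>n. G n y) \<longlonglongrightarrow> g y" if y: "y \<in> S" for y
  proof -
    show "(\<lambda>n. G n y) \<longlonglongrightarrow> g y"
      by (rule continuously_convergesD[OF cc filterlim_ident]) (use y in auto)
    then have "(\<lambda>n. \<bar>G n y\<bar>) \<longlonglongrightarrow> \<bar>g y\<bar>" by (rule tendsto_rabs)
    then show "\<bar>g y\<bar> \<le> M" by (rule LIMSEQ_le_const2) (use bound[OF y] in auto)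
  qed
  \<comment> \<open>The upper estimate takes the competitor \<open>n = N\<close>,
    \<open>y' = y\<close> in the infimum. The lower one separates competitors near \<open>y\<close>,
    controlled by continuous convergence, from distant ones, controlled by the penalty.\<close>
  have h_lim: "(\<lambda>N. h N y) \<longlonglongrightarrow> g y" if y: "y \<in> S" for y
  proof (rule order_tendstoI)
    fix c assume "g y < c"
    then have "\<forall>\<^sub>F n in sequentially. G n y < c" using G_lim[OF y] by (rule order_tendstoD(2)[rotated])
    then show "\<forall>\<^sub>F N in sequentially. h N y < c"
    proof eventually_elim
      case (elim n)
      with h_leG[OF order_refl y, of n] show ?case by simp
    qed
  next
    fix c assume "c < g y"
    define e where "e = (g y - c) / 2"
    have e: "e > 0" "c < g y - e" using \<open>c < g y\<close> by (auto simp: e_def field_simps)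
    obtain d N0 where d: "d > 0" "\<And>n x. n \<ge> N0 \<Longrightarrow> x \<in> S \<Longrightarrow> dist x y < d \<Longrightarrow> g y - e < G n x"
      using continuously_converges_eventually_ge[OF cc y e(1)] by blast
    \<comment> \<open>For such \<open>N\<close> the penalty at distance \<open>d\<close> is at least
      \<open>2 * M\<close>, so a distant competitor contributes at least
      \<open>- M + 2 * M = M\<close>, which dominates \<open>g y\<close>.\<close>
    have "c < h N y" if N: "N \<ge> N0" "N \<ge> nat \<lceil>2 * M / d\<rceil>" for N
    proof -
      have "2 * M / d \<le> real N" using N(2) by linarith
      then have NM: "2 * M \<le> real N * d" using d(1) by (simp add: field_simps)
      have "g y - e \<le> h N y"
      proof (rule h_ge[OF y])
        fix n x assume nx: "N \<le> n" "x \<in> S"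
        show "g y - e \<le> G n x + real N * dist y x"
        proof (cases "dist x y < d")
          case True
          then have "g y - e < G n x" using d(2)[of n x] N nx by auto
          moreover have "0 \<le> real N * dist y x" by simp
          ultimately show ?thesis by linarith
        next
          case False
          then have "real N * d \<le> real N * dist y x" by (intro mult_left_mono) (auto simp: dist_commute)
          moreover have "- M \<le> G n x" "g y \<le> M" using bound[OF nx(2), of n] g_bound[OF y] by auto
          ultimately show ?thesis using NM e by linarith
        qed
      qed
      with e show ?thesis by linarith
    qed
    then show "\<forall>\<^sub>F N in sequentially. c < h N y"
      unfolding eventually_sequentially by (intro exI[of _ "max N0 (nat \<lceil>2 * M / d\<rceil>)"]) auto
  qed
  have "(\<lambda>N. \<integral>x. h N x \<partial>\<mu>) \<longlonglongrightarrow> (\<integral>x. g x \<partial>\<mu>)"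
    by (rule prob_measures_bounded_convergence[OF \<mu> bounded_continuousD(1)[OF hbc], where M = M])
      (use h_bound h_lim in auto)
  \<comment> \<open>One \<open>N\<close> is now frozen by means of \<open>\<mu>\<close> alone. Weak
    convergence is then applied to the single function \<open>h N\<close>, which lies below
    \<open>G n\<close> as soon as \<open>n \<ge> N\<close>.\<close>
  then have "\<forall>\<^sub>F N in sequentially. (\<integral>x. g x \<partial>\<mu>) - e < (\<integral>x. h N x \<partial>\<mu>)"
    using e by (intro order_tendstoD(1)) auto
  then obtain N where N: "(\<integral>x. g x \<partial>\<mu>) - e < (\<integral>x. h N x \<partial>\<mu>)"
    by (auto simp: eventually_sequentially)
  have "(\<lambda>n. \<integral>x. h N x \<partial>\<mu>s n) \<longlonglongrightarrow> (\<integral>x. h N x \<partial>\<mu>)"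
    by (rule conv[unfolded converges_weakly_def, rule_format, OF hbc])
  from order_tendstoD(1)[OF this N] eventually_ge_at_top[of N] show ?thesis
  proof eventually_elim
    case (elim n)
    have "(\<integral>x. h N x \<partial>\<mu>s n) \<le> (\<integral>x. G n x \<partial>\<mu>s n)"
    proof (rule integral_mono)
      show "integrable (\<mu>s n) (h N)"
        by (rule prob_measures_integrable[OF \<mu>s bounded_continuousD(1)[OF hbc], where M = M]) (use h_bound in auto)
      show "integrable (\<mu>s n) (G n)"
        by (rule prob_measures_integrable[OF \<mu>s meas, where M = M]) (use bound in auto)
    qed (use h_leG elim(2) prob_measuresD(2)[OF \<mu>s] in auto)
    with elim(1) show ?case by linarith
  qed
qed

text \<open>Continuous convergence is stable under negation, so the one-sided estimate for
  \<open>G\<close> and for \<open>\<lambda>n x. - G n x\<close> gives both halves of the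
  limit.\<close>

lemma weak_convergence_integral:
  fixes S :: "'a::metric_space set"
  assumes \<mu>s: "\<And>n. \<mu>s n \<in> prob_measures (top_of_set S)" and \<mu>: "\<mu> \<in> prob_measures (top_of_set S)"
    and conv: "converges_weakly (top_of_set S) \<mu>s \<mu>"
    and meas: "\<And>n. G n \<in> borel_measurable (borel_of (top_of_set S))"
    and bound: "\<And>n x. x \<in> S \<Longrightarrow> \<bar>G n x\<bar> \<le> M"
    and cc: "continuously_converges S G g"
  shows "(\<lambda>n. \<integral>x. G n x \<partial>\<mu>s n) \<longlonglongrightarrow> (\<integral>x. g x \<partial>\<mu>)"
proof (rule order_tendstoI)
  fix c assume "c < (\<integral>x. g x \<partial>\<mu>)"
  then show "\<forall>\<^sub>F n in sequentially. c < (\<integral>x. G n x \<partial>\<mu>s n)"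
    using weak_convergence_integral_lower[OF assms, of "(\<integral>x. g x \<partial>\<mu>) - c"] by simp
next
  fix c assume c: "(\<integral>x. g x \<partial>\<mu>) < c"
  have "\<forall>\<^sub>F n in sequentially. (\<integral>x. - g x \<partial>\<mu>) - (c - (\<integral>x. g x \<partial>\<mu>)) < (\<integral>x. - G n x \<partial>\<mu>s n)"
    by (rule weak_convergence_integral_lower[OF \<mu>s \<mu> conv _ _ continuously_converges_uminus[OF cc], where M = M])
      (use meas bound c in auto)
  then show "\<forall>\<^sub>F n in sequentially. (\<integral>x. G n x \<partial>\<mu>s n) < c"
    by simp
qed

section \<open>The observation and filter kernels\<close>

lemma stochastic_kernelI:
  assumes "\<kappa> \<in> borel_of T2 \<rightarrow>\<^sub>M prob_algebra (borel_of T1)"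
  shows "stochastic_kernel T1 T2 \<kappa>"
  unfolding stochastic_kernel_def
  using measurable_space[OF assms] measurable_compose[OF assms measurable_measure_prob_algebra]
  by (auto simp: space_prob_algebra prob_measures_def)

lemma space_prob_algebra_borel_of [simp]: "space (prob_algebra (borel_of T)) = prob_measures T"
  by (auto simp: space_prob_algebra prob_measures_def)

text \<open>The bound \<open>K\<close> makes \<open>f + K\<close> nonnegative, so the rule for
  nonnegative integrals against a bind applies. All measures involved have mass one, hence the shift
  adds exactly \<open>K\<close> on both sides and cancels.\<close>

lemma integral_bind_prob_algebra:
  fixes f :: "'b \<Rightarrow> real"
  assumes M: "M \<in> space (prob_algebra L)" and N: "N \<in> L \<rightarrow>\<^sub>M prob_algebra B"
    and f: "f \<in> borel_measurable B" and bound: "\<And>x. x \<in> space B \<Longrightarrow> \<bar>f x\<bar> \<le> K"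
  shows "(\<integral>x. f x \<partial>(M \<bind> N)) = (\<integral>x. \<integral>y. f y \<partial>N x \<partial>M)"
proof -
  interpret M: prob_space M using M by (simp add: space_prob_algebra)
  have setsM: "sets M = sets L" and spaceM: "space M = space L"
    using M sets_eq_imp_space_eq[of M L] by (auto simp: space_prob_algebra)
  have NM: "N \<in> M \<rightarrow>\<^sub>M prob_algebra B" using N by (simp add: measurable_cong_sets[OF setsM refl])
  have setsMN: "sets (M \<bind> N) = sets B" by (rule sets_bind'[OF M N])
  have spaceMN: "space (M \<bind> N) = space B" by (rule sets_eq_imp_space_eq[OF setsMN])
  interpret MN: prob_space "M \<bind> N"
    by (rule M.prob_space_bind[OF _ measurable_prob_algebraD[OF NM]])
      (use measurable_space[OF NM] in \<open>auto simp: space_prob_algebra\<close>)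
  have Nx: "prob_space (N x)" "sets (N x) = sets B" "space (N x) = space B" if "x \<in> space M" for x
    using measurable_space[OF NM that] sets_eq_imp_space_eq[of "N x" B] by (auto simp: space_prob_algebra)
  have int: "integrable (N x) f" if x: "x \<in> space M" for x
  proof -
    interpret prob_space "N x" by (rule Nx(1)[OF x])
    show ?thesis
      by (rule integrable_const_bound[of _ K]) (use f bound in \<open>auto simp: Nx(3)[OF x] measurable_cong_sets[OF Nx(2)[OF x] refl]\<close>)
  qed
  have intMN: "integrable (M \<bind> N) f"
    by (rule MN.integrable_const_bound[of _ K]) (use f bound in \<open>auto simp: spaceMN measurable_cong_sets[OF setsMN refl]\<close>)
  have in_bound: "\<bar>\<integral>y. f y \<partial>N x\<bar> \<le> K" if x: "x \<in> space M" for x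
  proof -
    interpret prob_space "N x" by (rule Nx(1)[OF x])
    have "\<bar>\<integral>y. f y \<partial>N x\<bar> \<le> (\<integral>y. \<bar>f y\<bar> \<partial>N x)" by (rule integral_abs_bound)
    also have "\<dots> \<le> (\<integral>y. K \<partial>N x)"
      using int[OF x] bound by (intro integral_mono) (auto simp: Nx(3)[OF x])
    finally show ?thesis by (simp add: prob_space)
  qed
  have inner: "(\<lambda>x. \<integral>y. f y \<partial>N x) \<in> borel_measurable M"
    by (rule measurable_compose[OF measurable_prob_algebraD[OF NM] integral_measurable_subprob_algebra[OF f]])
  then have intM: "integrable M (\<lambda>x. \<integral>y. f y \<partial>N x)"
    by (intro M.integrable_const_bound[of _ K]) (use in_bound in auto)
  have "ennreal (\<integral>x. f x + K \<partial>(M \<bind> N)) = (\<integral>\<^sup>+x. ennreal (f x + K) \<partial>(M \<bind> N))"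
    using intMN bound by (intro nn_integral_eq_integral[symmetric]) (force simp: spaceMN abs_le_iff)+
  also have "\<dots> = (\<integral>\<^sup>+x. \<integral>\<^sup>+y. ennreal (f y + K) \<partial>N x \<partial>M)"
    using f by (intro nn_integral_bind[OF _ measurable_prob_algebraD[OF NM]]) auto
  also have "\<dots> = (\<integral>\<^sup>+x. ennreal ((\<integral>y. f y \<partial>N x) + K) \<partial>M)"
  proof (rule nn_integral_cong)
    fix x assume x: "x \<in> space M"
    interpret prob_space "N x" by (rule Nx(1)[OF x])
    have "(\<integral>\<^sup>+y. ennreal (f y + K) \<partial>N x) = ennreal (\<integral>y. f y + K \<partial>N x)"
      using int[OF x] bound by (intro nn_integral_eq_integral) (force simp: Nx(3)[OF x] abs_le_iff)+
    then show "(\<integral>\<^sup>+y. ennreal (f y + K) \<partial>N x) = ennreal ((\<integral>y. f y \<partial>N x) + K)"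
      using int[OF x] by (simp add: prob_space)
  qed
  also have "\<dots> = ennreal (\<integral>x. (\<integral>y. f y \<partial>N x) + K \<partial>M)"
    using intM in_bound by (intro nn_integral_eq_integral) (force simp: abs_le_iff)+
  finally have "(\<integral>x. f x + K \<partial>(M \<bind> N)) = (\<integral>x. (\<integral>y. f y \<partial>N x) + K \<partial>M)"
  proof (subst (asm) ennreal_inj)
    show "0 \<le> (\<integral>x. f x + K \<partial>(M \<bind> N))"
      by (rule integral_nonneg_AE) (use bound in \<open>force simp: spaceMN abs_le_iff intro: AE_I2\<close>)
    show "0 \<le> (\<integral>x. (\<integral>y. f y \<partial>N x) + K \<partial>M)"
      by (rule integral_nonneg_AE) (use in_bound in \<open>force simp: abs_le_iff intro: AE_I2\<close>)
  qed
  then show ?thesis using intMN intM by (simp add: M.prob_space MN.prob_space)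
qed

lemma borel_of_belief_action:
  fixes X :: "'x::{metric_space, second_countable_topology} set"
    and A :: "'a::{metric_space, second_countable_topology} set"
  shows "sets (borel_of (belief_action X A)) =
    sets (borel_of (weak_topology (top_of_set X)) \<Otimes>\<^sub>M borel_of (top_of_set A))"
  by (rule borel_of_prod_topology[OF second_countable_weak_topology second_countable_top_of_set])

lemma borel_of_belief_action_obs:
  fixes X :: "'x::{metric_space, second_countable_topology} set"
    and Y :: "'y::{metric_space, second_countable_topology} set"
    and A :: "'a::{metric_space, second_countable_topology} set"
  shows "sets (borel_of (belief_action_obs X A Y)) =
    sets (borel_of (weak_topology (top_of_set X)) \<Otimes>\<^sub>M (borel_of (top_of_set A) \<Otimes>\<^sub>M borel_of (top_of_set Y)))"
proof -
  have "second_countable (prod_space A Y)"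
    unfolding prod_space_eq by (rule second_countable_top_of_set)
  then show ?thesis
    by (rule trans[OF borel_of_prod_topology[OF second_countable_weak_topology]
          sets_pair_measure_cong[OF refl sets_borel_of_prod_space]])
qed

context
  fixes X :: "'x::{metric_space, second_countable_topology} set"
    and Y :: "'y::{metric_space, second_countable_topology} set"
    and A :: "'a::{metric_space, second_countable_topology} set"
    and H :: "'x measure \<times> 'a \<times> 'y \<Rightarrow> 'x measure"
  assumes H: "stochastic_kernel (top_of_set X) (belief_action_obs X A Y) H"
begin

lemma filter_measurable:
  "H \<in> borel_of (weak_topology (top_of_set X)) \<Otimes>\<^sub>M (borel_of (top_of_set A) \<Otimes>\<^sub>M borel_of (top_of_set Y))
    \<rightarrow>\<^sub>M prob_algebra (borel_of (top_of_set X))"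
  using stochastic_kernel_measurable[OF H] unfolding measurable_cong_sets[OF borel_of_belief_action_obs refl] .

lemma filter_section_measurable:
  assumes "z \<in> prob_measures (top_of_set X)" "a \<in> A"
  shows "(\<lambda>y. H (z, a, y)) \<in> borel_of (top_of_set Y) \<rightarrow>\<^sub>M prob_algebra (borel_of (top_of_set X))"
  by (rule measurable_compose[OF _ filter_measurable]) (use assms in auto)

lemma filter_prob_measures:
  assumes "z \<in> prob_measures (top_of_set X)" "a \<in> A" "y \<in> Y"
  shows "H (z, a, y) \<in> prob_measures (top_of_set X)"
  using H assms by (simp add: stochastic_kernel_def)

context
  fixes F :: "'x measure \<Rightarrow> real"
  assumes F: "bounded_continuous (weak_topology (top_of_set X)) F"
begin

lemma filter_integrand_measurable:
  assumes "z \<in> prob_measures (top_of_set X)" "a \<in> A"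
  shows "(\<lambda>y. F (H (z, a, y))) \<in> borel_measurable (borel_of (top_of_set Y))"
  by (rule measurable_compose[OF prob_algebra_measurable_weak_topology[OF filter_section_measurable[OF assms]]
        bounded_continuousD(1)[OF F]])

lemma filter_integrand_bounded:
  obtains M where "\<And>z a y. z \<in> prob_measures (top_of_set X) \<Longrightarrow> a \<in> A \<Longrightarrow> y \<in> Y \<Longrightarrow> \<bar>F (H (z, a, y))\<bar> \<le> M"
proof -
  obtain M where "\<forall>\<nu> \<in> prob_measures (top_of_set X). \<bar>F \<nu>\<bar> \<le> M"
    using bounded_continuousD(2)[OF F] by auto
  then show thesis using filter_prob_measures by (intro that) auto
qed

end

end

context
  fixes X :: "'x::{metric_space, second_countable_topology} set"
    and Y :: "'y::{metric_space, second_countable_topology} set"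
    and A :: "'a::{metric_space, second_countable_topology} set"
    and P :: "'x \<times> 'a \<Rightarrow> 'x measure" and Q :: "'a \<times> 'x \<Rightarrow> 'y measure"
  assumes P: "stochastic_kernel (top_of_set X) (prod_space X A) P"
    and Q: "stochastic_kernel (top_of_set Y) (prod_space A X) Q"
begin

text \<open>Both sides give a Borel set \<open>C\<close> the same iterated integral, by the
  rectangle formula for \<open>X \<times> C\<close>. The bind form gives access to the calculus of
  probability kernels for measurability and for iterated integration.\<close>

lemma obs_kernel_eq_bind:
  assumes z: "z \<in> prob_measures (top_of_set X)" and a: "a \<in> A"
  shows "obs_kernel X Y P Q (z, a) = z \<bind> (\<lambda>x. P (x, a) \<bind> (\<lambda>x'. Q (a, x')))"
proof -
  note Pm = P_measurable[OF P Q a] and Qm = Q_measurable[OF P Q a]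
  note K = measurable_bind_prob_space[OF Pm Qm]
  have z': "z \<in> space (prob_algebra (borel_of (top_of_set X)))" using z by simp
  have sets_bind: "sets (z \<bind> (\<lambda>x. P (x, a) \<bind> (\<lambda>x'. Q (a, x')))) = sets (borel_of (top_of_set Y))"
    by (rule sets_bind'[OF z' K])
  show ?thesis
  proof (rule measure_eqI)
    show "sets (obs_kernel X Y P Q (z, a)) = sets (z \<bind> (\<lambda>x. P (x, a) \<bind> (\<lambda>x'. Q (a, x'))))"
      unfolding sets_bind by (simp add: obs_kernel_def)
    fix C assume "C \<in> sets (obs_kernel X Y P Q (z, a))"
    then have C: "C \<in> sets (borel_of (top_of_set Y))" by (simp add: obs_kernel_def)
    have top: "X \<in> sets (borel_of (top_of_set X))"
      using sets.top[of "borel_of (top_of_set X)"] by simp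
    have PX: "P (x, a) \<in> prob_measures (top_of_set X)" if "x \<in> X" for x
      using measurable_space[OF Pm, of x] that by simp
    have spP: "space (P (x, a)) = X" if "x \<in> X" for x
      using prob_measuresD(2)[OF PX[OF that]] by simp
    have "emeasure (obs_kernel X Y P Q (z, a)) C =
        (\<integral>\<^sup>+x. (\<integral>\<^sup>+x'\<in>X. emeasure (Q (a, x')) C \<partial>P (x, a)) \<partial>z)"
      by (simp add: emeasure_obs_kernel[OF P Q C] emeasure_joint_kernel_rectangle[OF P Q z a top C])
    also have "\<dots> = (\<integral>\<^sup>+x. emeasure (P (x, a) \<bind> (\<lambda>x'. Q (a, x'))) C \<partial>z)"
    proof (rule nn_integral_cong)
      fix x assume "x \<in> space z"
      then have x: "x \<in> X" using prob_measuresD(2)[OF z] by simp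
      have "P (x, a) \<in> space (prob_algebra (borel_of (top_of_set X)))" using PX[OF x] by simp
      note emeasure_bind_prob_algebra[OF this Qm C]
      then show "(\<integral>\<^sup>+x'\<in>X. emeasure (Q (a, x')) C \<partial>P (x, a)) = emeasure (P (x, a) \<bind> (\<lambda>x'. Q (a, x'))) C"
        by (auto intro!: nn_integral_cong simp: spP[OF x])
    qed
    also have "\<dots> = emeasure (z \<bind> (\<lambda>x. P (x, a) \<bind> (\<lambda>x'. Q (a, x')))) C"
      by (rule emeasure_bind_prob_algebra[OF z' K C, symmetric])
    finally show "emeasure (obs_kernel X Y P Q (z, a)) C = emeasure (z \<bind> (\<lambda>x. P (x, a) \<bind> (\<lambda>x'. Q (a, x')))) C" .
  qed
qed

lemma integral_obs_kernel:
  assumes z: "z \<in> prob_measures (top_of_set X)" and a: "a \<in> A"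
    and g: "bounded_continuous (top_of_set Y) g"
  shows "(\<integral>y. g y \<partial>obs_kernel X Y P Q (z, a)) = (\<integral>x. \<integral>x'. \<integral>y. g y \<partial>Q (a, x') \<partial>P (x, a) \<partial>z)"
proof -
  note Pm = P_measurable[OF P Q a] and Qm = Q_measurable[OF P Q a]
  note gm = bounded_continuousD(1)[OF g]
  obtain K where K: "\<And>y. y \<in> Y \<Longrightarrow> \<bar>g y\<bar> \<le> K" using bounded_continuousD(2)[OF g] by auto
  then have K': "\<And>y. y \<in> space (borel_of (top_of_set Y)) \<Longrightarrow> \<bar>g y\<bar> \<le> K" by simp
  have z': "z \<in> space (prob_algebra (borel_of (top_of_set X)))" using z by simp
  have "(\<integral>y. g y \<partial>obs_kernel X Y P Q (z, a)) = (\<integral>x. \<integral>y. g y \<partial>(P (x, a) \<bind> (\<lambda>x'. Q (a, x'))) \<partial>z)"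
    unfolding obs_kernel_eq_bind[OF z a]
    by (rule integral_bind_prob_algebra[OF z' measurable_bind_prob_space[OF Pm Qm] gm K'])
  also have "\<dots> = (\<integral>x. \<integral>x'. \<integral>y. g y \<partial>Q (a, x') \<partial>P (x, a) \<partial>z)"
  proof (rule Bochner_Integration.integral_cong[OF refl])
    fix x assume "x \<in> space z"
    then have "P (x, a) \<in> space (prob_algebra (borel_of (top_of_set X)))"
      using measurable_space[OF Pm, of x] prob_measuresD(2)[OF z] by simp
    then show "(\<integral>y. g y \<partial>(P (x, a) \<bind> (\<lambda>x'. Q (a, x')))) = (\<integral>x'. \<integral>y. g y \<partial>Q (a, x') \<partial>P (x, a))"
      by (rule integral_bind_prob_algebra[OF _ Qm gm K'])
  qed
  finally show ?thesis .
qed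

text \<open>Measurability in the belief \<open>z\<close> is the delicate coordinate: binding
  requires \<open>z\<close> as an element of \<open>prob_algebra\<close>, which is what the
  measurability of the identity from the weak Borel space supplies. The rest is composition of
  measurable kernels.\<close>

lemma obs_kernel_measurable:
  "obs_kernel X Y P Q \<in> borel_of (belief_action X A) \<rightarrow>\<^sub>M prob_algebra (borel_of (top_of_set Y))"
proof -
  let ?W = "borel_of (weak_topology (top_of_set X))" and ?X = "borel_of (top_of_set X)"
    and ?A = "borel_of (top_of_set A)" and ?Y = "borel_of (top_of_set Y)"
  have Pm: "P \<in> ?X \<Otimes>\<^sub>M ?A \<rightarrow>\<^sub>M prob_algebra ?X"
    using stochastic_kernel_measurable[OF P] unfolding measurable_cong_sets[OF sets_borel_of_prod_space refl] .
  have Qm: "Q \<in> ?A \<Otimes>\<^sub>M ?X \<rightarrow>\<^sub>M prob_algebra ?Y"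
    using stochastic_kernel_measurable[OF Q] unfolding measurable_cong_sets[OF sets_borel_of_prod_space refl] .
  have "(\<lambda>s. fst s \<bind> (\<lambda>x. P (x, snd s) \<bind> (\<lambda>x'. Q (snd s, x')))) \<in> ?W \<Otimes>\<^sub>M ?A \<rightarrow>\<^sub>M prob_algebra ?Y"
  proof (rule measurable_bind_prob_space2[where N = ?X])
    show "fst \<in> ?W \<Otimes>\<^sub>M ?A \<rightarrow>\<^sub>M prob_algebra ?X"
      using measurable_compose[OF measurable_fst measurable_prob_algebra_borel_of_weak] .
    have "(\<lambda>t. P (snd t, snd (fst t)) \<bind> (\<lambda>x'. Q (snd (fst t), x')))
        \<in> (?W \<Otimes>\<^sub>M ?A) \<Otimes>\<^sub>M ?X \<rightarrow>\<^sub>M prob_algebra ?Y"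
    proof (rule measurable_bind_prob_space2[where N = ?X])
      show "(\<lambda>t. P (snd t, snd (fst t))) \<in> (?W \<Otimes>\<^sub>M ?A) \<Otimes>\<^sub>M ?X \<rightarrow>\<^sub>M prob_algebra ?X"
        by (rule measurable_compose[OF _ Pm]) measurable
      have "(\<lambda>u. Q (snd (fst (fst u)), snd u)) \<in> ((?W \<Otimes>\<^sub>M ?A) \<Otimes>\<^sub>M ?X) \<Otimes>\<^sub>M ?X \<rightarrow>\<^sub>M prob_algebra ?Y"
        by (rule measurable_compose[OF _ Qm]) measurable
      then show "(\<lambda>(t, x'). Q (snd (fst t), x')) \<in> ((?W \<Otimes>\<^sub>M ?A) \<Otimes>\<^sub>M ?X) \<Otimes>\<^sub>M ?X \<rightarrow>\<^sub>M prob_algebra ?Y"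
        by (simp add: case_prod_unfold)
    qed
    then show "(\<lambda>(s, x). P (x, snd s) \<bind> (\<lambda>x'. Q (snd s, x')))
        \<in> (?W \<Otimes>\<^sub>M ?A) \<Otimes>\<^sub>M ?X \<rightarrow>\<^sub>M prob_algebra ?Y"
      by (simp add: case_prod_unfold)
  qed
  also have "?this \<longleftrightarrow> obs_kernel X Y P Q \<in> ?W \<Otimes>\<^sub>M ?A \<rightarrow>\<^sub>M prob_algebra ?Y"
    by (rule measurable_cong) (auto simp: space_pair_measure obs_kernel_eq_bind)
  finally show ?thesis unfolding measurable_cong_sets[OF borel_of_belief_action refl] .
qed

lemma obs_kernel_prob_measures:
  "z \<in> prob_measures (top_of_set X) \<Longrightarrow> a \<in> A \<Longrightarrow> obs_kernel X Y P Q (z, a) \<in> prob_measures (top_of_set Y)"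
  using measurable_space[OF obs_kernel_measurable, of "(z, a)"] by simp

context
  fixes H :: "'x measure \<times> 'a \<times> 'y \<Rightarrow> 'x measure"
  assumes H: "stochastic_kernel (top_of_set X) (belief_action_obs X A Y) H"
begin

text \<open>A jointly measurable pushforward of a measurable kernel is a measurable kernel. Joint
  measurability of \<open>H\<close> into the weak Borel space, not merely of its evaluations, is
  what the pushforward requires.\<close>

lemma stochastic_kernel_filter_kernel:
  "stochastic_kernel (weak_topology (top_of_set X)) (belief_action X A) (filter_kernel X Y P Q H)"
proof (rule stochastic_kernelI)
  let ?W = "borel_of (weak_topology (top_of_set X))"
    and ?A = "borel_of (top_of_set A)" and ?Y = "borel_of (top_of_set Y)"
  have "(\<lambda>t. H (fst (fst t), snd (fst t), snd t)) \<in> (?W \<Otimes>\<^sub>M ?A) \<Otimes>\<^sub>M ?Y \<rightarrow>\<^sub>M ?W"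
    by (rule measurable_compose[OF _ prob_algebra_measurable_weak_topology[OF filter_measurable[OF H]]]) measurable
  then have "(\<lambda>s. distr (obs_kernel X Y P Q s) ?W (\<lambda>y. H (fst s, snd s, y))) \<in> ?W \<Otimes>\<^sub>M ?A \<rightarrow>\<^sub>M prob_algebra ?W"
    using obs_kernel_measurable unfolding measurable_cong_sets[OF borel_of_belief_action refl]
    by (intro measurable_distr_prob_space2[where M = ?Y]) (simp_all add: case_prod_unfold)
  then show "filter_kernel X Y P Q H \<in> borel_of (belief_action X A) \<rightarrow>\<^sub>M prob_algebra ?W"
    unfolding measurable_cong_sets[OF borel_of_belief_action refl]
    by (simp add: filter_kernel_def case_prod_unfold)
qed

lemma integral_filter_kernel:
  fixes F :: "'x measure \<Rightarrow> real"
  assumes z: "z \<in> prob_measures (top_of_set X)" and a: "a \<in> A"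
    and F: "F \<in> borel_measurable (borel_of (weak_topology (top_of_set X)))"
  shows "(\<integral>\<nu>. F \<nu> \<partial>filter_kernel X Y P Q H (z, a)) = (\<integral>y. F (H (z, a, y)) \<partial>obs_kernel X Y P Q (z, a))"
  unfolding filter_kernel_def case_prod_conv
  by (rule integral_distr[OF _ F])
    (simp add: measurable_cong_sets[OF prob_measuresD(1)[OF obs_kernel_prob_measures[OF z a]] refl]
      prob_algebra_measurable_weak_topology[OF filter_section_measurable[OF H z a]])

end

end

section \<open>Weak continuity of the filter kernel\<close>

lemma limitin_top_of_set_iff:
  "limitin (top_of_set S) f l F \<longleftrightarrow> l \<in> S \<and> (\<forall>\<^sub>F x in F. f x \<in> S) \<and> (f \<longlongrightarrow> l) F"
  by (simp add: limitin_subtopology)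

lemma converges_weakly_subseq:
  assumes "converges_weakly T \<mu>s \<mu>" "filterlim r sequentially sequentially"
  shows "converges_weakly T (\<lambda>k. \<mu>s (r k)) \<mu>"
  unfolding converges_weakly_def
proof (intro allI impI)
  fix f assume "bounded_continuous T f"
  with assms(1) have "(\<lambda>n. \<integral>x. f x \<partial>\<mu>s n) \<longlonglongrightarrow> (\<integral>x. f x \<partial>\<mu>)" by (simp add: converges_weakly_def)
  from filterlim_compose[OF this assms(2)]
  show "(\<lambda>k. \<integral>x. f x \<partial>\<mu>s (r k)) \<longlonglongrightarrow> (\<integral>x. f x \<partial>\<mu>)" .
qed

lemma bounded_continuous_converges_weakly:
  assumes F: "bounded_continuous (weak_topology T) F" and "\<And>k. \<mu>s k \<in> prob_measures T" "\<mu> \<in> prob_measures T"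
    and "converges_weakly T \<mu>s \<mu>"
  shows "(\<lambda>k. F (\<mu>s k)) \<longlonglongrightarrow> F \<mu>"
proof -
  have "limitin (weak_topology T) \<mu>s \<mu> sequentially"
    using assms(2-4) by (simp add: limitin_weak_topology_iff)
  moreover have "continuous_map (weak_topology T) euclideanreal F"
    using F by (simp add: bounded_continuous_def)
  ultimately have "limitin euclideanreal (F \<circ> \<mu>s) (F \<mu>) sequentially"
    by (rule continuous_map_limit[rotated])
  then show ?thesis by (simp add: comp_def)
qed

lemma weakly_continuous_cong:
  assumes "weakly_continuous T1 T2 \<kappa>'" and eq: "\<And>s. s \<in> topspace T2 \<Longrightarrow> \<kappa> s = \<kappa>' s"
  shows "weakly_continuous T1 T2 \<kappa>"
  unfolding weakly_continuous_def
proof (intro allI impI, elim conjE)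
  fix \<sigma> s assume \<sigma>: "\<forall>n. \<sigma> n \<in> topspace T2" and lim: "limitin T2 \<sigma> s sequentially"
  have "converges_weakly T1 (\<lambda>n. \<kappa>' (\<sigma> n)) (\<kappa>' s)"
    using assms(1) \<sigma> lim by (simp add: weakly_continuous_def)
  with \<sigma> eq limitin_topspace[OF lim] show "converges_weakly T1 (\<lambda>n. \<kappa> (\<sigma> n)) (\<kappa> s)" by simp
qed

lemma weakly_continuous_belief_actionI:
  assumes "\<And>zs z as a. (\<And>n. zs n \<in> prob_measures (top_of_set X)) \<Longrightarrow> z \<in> prob_measures (top_of_set X) \<Longrightarrow>
      converges_weakly (top_of_set X) zs z \<Longrightarrow> (\<And>n. as n \<in> A) \<Longrightarrow> a \<in> A \<Longrightarrow> as \<longlonglongrightarrow> a \<Longrightarrow>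
      converges_weakly T (\<lambda>n. \<kappa> (zs n, as n)) (\<kappa> (z, a))"
  shows "weakly_continuous T (belief_action X A) \<kappa>"
  unfolding weakly_continuous_def
proof (intro allI impI, elim conjE)
  fix \<sigma> s
  assume \<sigma>: "\<forall>n. \<sigma> n \<in> topspace (belief_action X A)" and lim: "limitin (belief_action X A) \<sigma> s sequentially"
  have mem: "fst (\<sigma> n) \<in> prob_measures (top_of_set X)" "snd (\<sigma> n) \<in> A" for n
    using \<sigma> by (auto simp: mem_Times_iff)
  have "converges_weakly T (\<lambda>n. \<kappa> (fst (\<sigma> n), snd (\<sigma> n))) (\<kappa> (fst s, snd s))"
    by (rule assms) (use mem lim in \<open>auto simp: limitin_pairwise comp_def limitin_weak_topology_iff limitin_top_of_set_iff\<close>)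
  then show "converges_weakly T (\<lambda>n. \<kappa> (\<sigma> n)) (\<kappa> s)" by simp
qed

lemma limitin_belief_actionI:
  assumes "\<And>n. zs n \<in> prob_measures (top_of_set X)" "z \<in> prob_measures (top_of_set X)"
    "converges_weakly (top_of_set X) zs z" "\<And>n. as n \<in> A" "a \<in> A" "as \<longlonglongrightarrow> a"
  shows "limitin (belief_action X A) (\<lambda>n. (zs n, as n)) (z, a) sequentially"
  unfolding limitin_pairwise limitin_weak_topology_iff limitin_top_of_set_iff
  using assms by (simp add: comp_def)

lemma weakly_continuous_belief_action_obsD:
  assumes "weakly_continuous T (belief_action_obs X A Y) \<kappa>"
    and "\<And>n. zs n \<in> prob_measures (top_of_set X)" "z \<in> prob_measures (top_of_set X)"
      "converges_weakly (top_of_set X) zs z" "\<And>n. as n \<in> A" "a \<in> A" "as \<longlonglongrightarrow> a"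
      "\<And>n. ys n \<in> Y" "y \<in> Y" "ys \<longlonglongrightarrow> y"
  shows "converges_weakly T (\<lambda>n. \<kappa> (zs n, as n, ys n)) (\<kappa> (z, a, y))"
proof -
  have "limitin (belief_action_obs X A Y) (\<lambda>n. (zs n, as n, ys n)) (z, a, y) sequentially"
    unfolding limitin_pairwise limitin_weak_topology_iff limitin_top_of_set_iff
    using assms(2-) by (simp add: comp_def)
  with assms show ?thesis
    unfolding weakly_continuous_def by simp
qed

lemma weakly_continuous_prod_spaceD:
  assumes "weakly_continuous T (prod_space S S') \<kappa>"
    and "\<And>n. xs n \<in> S" "x \<in> S" "xs \<longlonglongrightarrow> x" "\<And>n. ys n \<in> S'" "y \<in> S'" "ys \<longlonglongrightarrow> y"
  shows "converges_weakly T (\<lambda>n. \<kappa> (xs n, ys n)) (\<kappa> (x, y))"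
proof -
  have "limitin (prod_space S S') (\<lambda>n. (xs n, ys n)) (x, y) sequentially"
    unfolding limitin_pairwise limitin_top_of_set_iff using assms(2-) by (auto simp: comp_def)
  with assms show ?thesis
    unfolding weakly_continuous_def by simp
qed

context
  fixes X :: "'x::{metric_space, second_countable_topology} set"
    and Y :: "'y::{metric_space, second_countable_topology} set"
    and A :: "'a::{metric_space, second_countable_topology} set"
    and P :: "'x \<times> 'a \<Rightarrow> 'x measure" and Q :: "'a \<times> 'x \<Rightarrow> 'y measure"
  assumes P: "stochastic_kernel (top_of_set X) (prod_space X A) P"
    and Q: "stochastic_kernel (top_of_set Y) (prod_space A X) Q"
begin

lemma obs_kernel_weakly_continuous:
  assumes Pc: "weakly_continuous (top_of_set X) (prod_space X A) P"
    and Qc: "weakly_continuous (top_of_set Y) (prod_space A X) Q"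
  shows "weakly_continuous (top_of_set Y) (belief_action X A) (obs_kernel X Y P Q)"
proof (rule weakly_continuous_belief_actionI)
  fix zs z as a
  assume zs: "\<And>n. zs n \<in> prob_measures (top_of_set X)" and z: "z \<in> prob_measures (top_of_set X)"
    and zlim: "converges_weakly (top_of_set X) zs z"
    and as: "\<And>n. as n \<in> A" and a: "a \<in> A" and alim: "as \<longlonglongrightarrow> a"
  have PX: "P (x, b) \<in> prob_measures (top_of_set X)" if "x \<in> X" "b \<in> A" for x b
    using P that by (simp add: stochastic_kernel_def)
  have QY: "Q (b, x) \<in> prob_measures (top_of_set Y)" if "x \<in> X" "b \<in> A" for x b
    using Q that by (simp add: stochastic_kernel_def)
  show "converges_weakly (top_of_set Y) (\<lambda>n. obs_kernel X Y P Q (zs n, as n)) (obs_kernel X Y P Q (z, a))"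
    unfolding converges_weakly_def
  proof (intro allI impI)
    fix g assume g: "bounded_continuous (top_of_set Y) g"
    note gm = bounded_continuousD(1)[OF g]
    obtain M where M: "\<And>y. y \<in> Y \<Longrightarrow> \<bar>g y\<bar> \<le> M" using bounded_continuousD(2)[OF g] by auto
    \<comment> \<open>\<open>G\<close> and \<open>K\<close> are the successive inner integrals over
      \<open>Q\<close> and \<open>P\<close>; both depend on the action, so along \<open>as\<close>
      they are moving integrands even though \<open>g\<close> is fixed.\<close>
    define G where "G b x' = (\<integral>y. g y \<partial>Q (b, x'))" for b x'
    define K where "K b x = (\<integral>x'. G b x' \<partial>P (x, b))" for b x
    have Gm: "G b \<in> borel_measurable (borel_of (top_of_set X))" if "b \<in> A" for b
      unfolding G_def
      by (rule measurable_compose[OF measurable_prob_algebraD[OF Q_measurable[OF P Q that]]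
            integral_measurable_subprob_algebra[OF gm]])
    have Km: "K b \<in> borel_measurable (borel_of (top_of_set X))" if "b \<in> A" for b
      unfolding K_def
      by (rule measurable_compose[OF measurable_prob_algebraD[OF P_measurable[OF P Q that]]
            integral_measurable_subprob_algebra[OF Gm[OF that]]])
    have Gb: "\<bar>G b x\<bar> \<le> M" if "b \<in> A" "x \<in> X" for b x
      unfolding G_def by (rule prob_measures_integral_abs_le[OF QY gm]) (use that M in auto)
    have Kb: "\<bar>K b x\<bar> \<le> M" if "b \<in> A" "x \<in> X" for b x
      unfolding K_def by (rule prob_measures_integral_abs_le[OF PX Gm]) (use that Gb in auto)
    have Gcc: "continuously_converges X (\<lambda>n. G (as n)) (G a)"
    proof (rule continuously_convergesI)
      fix r :: "nat \<Rightarrow> nat" and xs x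
      assume r: "filterlim r sequentially sequentially" and x: "\<And>k. xs k \<in> X" "x \<in> X" "xs \<longlonglongrightarrow> x"
      have "converges_weakly (top_of_set Y) (\<lambda>k. Q (as (r k), xs k)) (Q (a, x))"
        by (rule weakly_continuous_prod_spaceD[OF Qc as a filterlim_compose[OF alim r] x])
      with g show "(\<lambda>k. G (as (r k)) (xs k)) \<longlonglongrightarrow> G a x" by (simp add: converges_weakly_def G_def)
    qed
    have Kcc: "continuously_converges X (\<lambda>n. K (as n)) (K a)"
    proof (rule continuously_convergesI)
      fix r :: "nat \<Rightarrow> nat" and xs x
      assume r: "filterlim r sequentially sequentially" and x: "\<And>k. xs k \<in> X" "x \<in> X" "xs \<longlonglongrightarrow> x"
      have conv: "converges_weakly (top_of_set X) (\<lambda>k. P (xs k, as (r k))) (P (x, a))"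
        by (rule weakly_continuous_prod_spaceD[OF Pc x as a filterlim_compose[OF alim r]])
      \<comment> \<open>Here the integrand \<open>G (as (r k))\<close> and the measure
        \<open>P (xs k, as (r k))\<close> both vary, so continuous convergence of \<open>G\<close>,
        along the index map \<open>r\<close>, is what propagates to \<open>K\<close>.\<close>
      show "(\<lambda>k. K (as (r k)) (xs k)) \<longlonglongrightarrow> K a x"
        unfolding K_def
        by (rule weak_convergence_integral[OF PX[OF x(1) as] PX[OF x(2) a] conv Gm[OF as] Gb[OF as]
              continuously_converges_subseq[OF Gcc r]])
    qed
    have "(\<lambda>n. \<integral>x. K (as n) x \<partial>zs n) \<longlonglongrightarrow> (\<integral>x. K a x \<partial>z)"
      by (rule weak_convergence_integral[OF zs z zlim Km[OF as] Kb[OF as] Kcc])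
    then show "(\<lambda>n. \<integral>y. g y \<partial>obs_kernel X Y P Q (zs n, as n)) \<longlonglongrightarrow> (\<integral>y. g y \<partial>obs_kernel X Y P Q (z, a))"
      by (simp add: integral_obs_kernel[OF P Q zs as g] integral_obs_kernel[OF P Q z a g] K_def G_def)
  qed
qed

section \<open>Almost sure uniqueness of the filter and the two cases\<close>

text \<open>For fixed \<open>B\<close>, equation (F) says that the two evaluations at
  \<open>B\<close> have equal integrals over every observable set, so they agree almost surely. The
  null set depends on \<open>B\<close>; a countable generating pi-system merges these null sets into
  one, off which the two probability measures coincide.\<close>

lemma filtering_equation_AE_unique:
  assumes H: "stochastic_kernel (top_of_set X) (belief_action_obs X A Y) H" "filtering_equation X Y A P Q H"
    and H': "stochastic_kernel (top_of_set X) (belief_action_obs X A Y) H'" "filtering_equation X Y A P Q H'"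
    and z: "z \<in> prob_measures (top_of_set X)" and a: "a \<in> A"
  shows "AE y in obs_kernel X Y P Q (z, a). H (z, a, y) = H' (z, a, y)"
proof -
  let ?R = "obs_kernel X Y P Q (z, a)"
  note R = obs_kernel_prob_measures[OF P Q z a]
  interpret prob_space ?R using prob_measuresD(3)[OF R] .
  note Hm = filter_section_measurable[OF H(1) z a] and Hm' = filter_section_measurable[OF H'(1) z a]
  obtain G where G: "countable G" "Int_stable G" "topspace (top_of_set X) \<in> G" "G \<subseteq> Pow (topspace (top_of_set X))"
    "sets (borel_of (top_of_set X)) = sigma_sets (topspace (top_of_set X)) G"
    by (rule countable_generator_borel_of[OF second_countable_top_of_set[of X]])
  have "AE y in ?R. emeasure (H (z, a, y)) B = emeasure (H' (z, a, y)) B" if "B \<in> G" for B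
  proof (rule density_unique_finite_measure)
    have B: "B \<in> sets (borel_of (top_of_set X))" unfolding G(5) using that by (rule sigma_sets.Basic)
    show "(\<lambda>y. emeasure (H (z, a, y)) B) \<in> borel_measurable ?R"
      "(\<lambda>y. emeasure (H' (z, a, y)) B) \<in> borel_measurable ?R"
      using measurable_compose[OF measurable_prob_algebraD[OF Hm] measurable_emeasure_subprob_algebra[OF B]]
        measurable_compose[OF measurable_prob_algebraD[OF Hm'] measurable_emeasure_subprob_algebra[OF B]]
      by (auto intro: prob_measures_measurable[OF R])
    fix C assume "C \<in> sets ?R"
    then have C: "C \<in> sets (borel_of (top_of_set Y))" by (simp add: prob_measuresD(1)[OF R])
    show "(\<integral>\<^sup>+y\<in>C. emeasure (H (z, a, y)) B \<partial>?R) = (\<integral>\<^sup>+y\<in>C. emeasure (H' (z, a, y)) B \<partial>?R)"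
      using H(2)[unfolded filtering_equation_def, rule_format, OF z a B C]
        H'(2)[unfolded filtering_equation_def, rule_format, OF z a B C] by simp
  qed auto
  then have "AE y in ?R. \<forall>B\<in>G. emeasure (H (z, a, y)) B = emeasure (H' (z, a, y)) B"
    using G(1) by (rule AE_ball_countable')
  with AE_space show ?thesis
  proof eventually_elim
    case (elim y)
    then have y: "y \<in> space (borel_of (top_of_set Y))" using prob_measuresD(2)[OF R] by simp
    have HP: "H (z, a, y) \<in> prob_measures (top_of_set X)" "H' (z, a, y) \<in> prob_measures (top_of_set X)"
      using measurable_space[OF Hm y] measurable_space[OF Hm' y] by auto
    interpret Hy: prob_space "H (z, a, y)" using prob_measuresD(3)[OF HP(1)] .
    show ?case
      by (rule measure_eqI_generator_eq[OF G(2) G(4), where A = "\<lambda>_. topspace (top_of_set X)"])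
        (use elim(2) G(3,5) prob_measuresD(1)[OF HP(1)] prob_measuresD(1)[OF HP(2)] in auto)
  qed
qed

lemma filter_kernel_unique:
  assumes H: "stochastic_kernel (top_of_set X) (belief_action_obs X A Y) H" "filtering_equation X Y A P Q H"
    and H': "stochastic_kernel (top_of_set X) (belief_action_obs X A Y) H'" "filtering_equation X Y A P Q H'"
    and s: "s \<in> topspace (belief_action X A)"
  shows "filter_kernel X Y P Q H s = filter_kernel X Y P Q H' s"
proof -
  obtain z a where za: "s = (z, a)" "z \<in> prob_measures (top_of_set X)" "a \<in> A" using s by auto
  note R = obs_kernel_prob_measures[OF P Q za(2,3)]
  show ?thesis unfolding za(1) filter_kernel_def case_prod_conv
    by (intro distr_cong_AE refl filtering_equation_AE_unique[OF H H' za(2,3)])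
      (simp_all add: measurable_cong_sets[OF prob_measuresD(1)[OF R] refl]
        prob_algebra_measurable_weak_topology[OF filter_section_measurable[OF H(1) za(2,3)]]
        prob_algebra_measurable_weak_topology[OF filter_section_measurable[OF H'(1) za(2,3)]])
qed

lemma filter_kernel_weakly_continuous:
  assumes Pc: "weakly_continuous (top_of_set X) (prod_space X A) P"
    and Qc: "weakly_continuous (top_of_set Y) (prod_space A X) Q"
    and H: "stochastic_kernel (top_of_set X) (belief_action_obs X A Y) H"
    and Hc: "weakly_continuous (top_of_set X) (belief_action_obs X A Y) H"
  shows "weakly_continuous (weak_topology (top_of_set X)) (belief_action X A) (filter_kernel X Y P Q H)"
proof (rule weakly_continuous_belief_actionI)
  fix zs z as a
  assume zs: "\<And>n. zs n \<in> prob_measures (top_of_set X)" and z: "z \<in> prob_measures (top_of_set X)"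
    and zlim: "converges_weakly (top_of_set X) zs z"
    and as: "\<And>n. as n \<in> A" and a: "a \<in> A" and alim: "as \<longlonglongrightarrow> a"
  let ?R = "obs_kernel X Y P Q"
  have Rconv: "converges_weakly (top_of_set Y) (\<lambda>n. ?R (zs n, as n)) (?R (z, a))"
    using obs_kernel_weakly_continuous[OF Pc Qc] limitin_belief_actionI[OF zs z zlim as a alim] zs as
    unfolding weakly_continuous_def by simp
  show "converges_weakly (weak_topology (top_of_set X)) (\<lambda>n. filter_kernel X Y P Q H (zs n, as n))
      (filter_kernel X Y P Q H (z, a))"
    unfolding converges_weakly_def
  proof (intro allI impI)
    fix F assume F: "bounded_continuous (weak_topology (top_of_set X)) F"
    note Fm = bounded_continuousD(1)[OF F] and HP = filter_prob_measures[OF H]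
    obtain M where M: "\<And>z a y. z \<in> prob_measures (top_of_set X) \<Longrightarrow> a \<in> A \<Longrightarrow> y \<in> Y \<Longrightarrow> \<bar>F (H (z, a, y))\<bar> \<le> M"
      by (rule filter_integrand_bounded[OF H F]) (rule that)
    \<comment> \<open>Joint weak continuity of \<open>H\<close> allows the belief, the action and
      the observation to move at the same time, which is exactly continuous convergence in
      \<open>y\<close>; the continuous function \<open>F\<close> preserves it.\<close>
    have cc: "continuously_converges Y (\<lambda>n y. F (H (zs n, as n, y))) (\<lambda>y. F (H (z, a, y)))"
    proof (rule continuously_convergesI)
      fix r :: "nat \<Rightarrow> nat" and ys y
      assume r: "filterlim r sequentially sequentially" and y: "\<And>k. ys k \<in> Y" "y \<in> Y" "ys \<longlonglongrightarrow> y"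
      have "converges_weakly (top_of_set X) (\<lambda>k. H (zs (r k), as (r k), ys k)) (H (z, a, y))"
        by (rule weakly_continuous_belief_action_obsD[OF Hc zs z converges_weakly_subseq[OF zlim r] as a
              filterlim_compose[OF alim r] y])
      then show "(\<lambda>k. F (H (zs (r k), as (r k), ys k))) \<longlonglongrightarrow> F (H (z, a, y))"
        by (rule bounded_continuous_converges_weakly[OF F HP[OF zs as y(1)] HP[OF z a y(2)]])
    qed
    show "(\<lambda>n. \<integral>\<nu>. F \<nu> \<partial>filter_kernel X Y P Q H (zs n, as n)) \<longlonglongrightarrow> (\<integral>\<nu>. F \<nu> \<partial>filter_kernel X Y P Q H (z, a))"
      unfolding integral_filter_kernel[OF P Q H zs as Fm] integral_filter_kernel[OF P Q H z a Fm]
      by (rule weak_convergence_integral[OF obs_kernel_prob_measures[OF P Q zs as] obs_kernel_prob_measures[OF P Q z a]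
            Rconv filter_integrand_measurable[OF H F zs as] M[OF zs as] cc])
  qed
qed

text \<open>Convergence of the filters is available only along a subsequence chosen after the
  sequence. Since every subsequence again satisfies the premises, every subsequence of the integrals
  has a further one with limit \<open>L\<close>, and this forces convergence of the full
  sequence.\<close>

lemma filter_kernel_weakly_continuous_of_setwise:
  assumes Rc: "setwise_continuous (top_of_set Y) (belief_action X A) (obs_kernel X Y P Q)"
    and H: "stochastic_kernel (top_of_set X) (belief_action_obs X A Y) H"
    and Hsub: "\<And>zs z as a. (\<And>n. zs n \<in> prob_measures (top_of_set X)) \<Longrightarrow> z \<in> prob_measures (top_of_set X) \<Longrightarrow>
        converges_weakly (top_of_set X) zs z \<Longrightarrow> (\<And>n. as n \<in> A) \<Longrightarrow> a \<in> A \<Longrightarrow> as \<longlonglongrightarrow> a \<Longrightarrow>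
        \<exists>k C. strict_mono k \<and> C \<in> sets (borel_of (top_of_set Y)) \<and>
          emeasure (obs_kernel X Y P Q (z, a)) C = 1 \<and>
          (\<forall>y \<in> C. converges_weakly (top_of_set X) (\<lambda>n. H (zs (k n), as (k n), y)) (H (z, a, y)))"
  shows "weakly_continuous (weak_topology (top_of_set X)) (belief_action X A) (filter_kernel X Y P Q H)"
proof (rule weakly_continuous_belief_actionI)
  fix zs z as a
  assume zs: "\<And>n. zs n \<in> prob_measures (top_of_set X)" and z: "z \<in> prob_measures (top_of_set X)"
    and zlim: "converges_weakly (top_of_set X) zs z"
    and as: "\<And>n. as n \<in> A" and a: "a \<in> A" and alim: "as \<longlonglongrightarrow> a"
  let ?R = "obs_kernel X Y P Q"
  note R = obs_kernel_prob_measures[OF P Q z a]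
  show "converges_weakly (weak_topology (top_of_set X)) (\<lambda>n. filter_kernel X Y P Q H (zs n, as n))
      (filter_kernel X Y P Q H (z, a))"
    unfolding converges_weakly_def
  proof (intro allI impI)
    fix F assume F: "bounded_continuous (weak_topology (top_of_set X)) F"
    note Fm = bounded_continuousD(1)[OF F] and HP = filter_prob_measures[OF H]
    obtain M where M: "\<And>z a y. z \<in> prob_measures (top_of_set X) \<Longrightarrow> a \<in> A \<Longrightarrow> y \<in> Y \<Longrightarrow> \<bar>F (H (z, a, y))\<bar> \<le> M"
      by (rule filter_integrand_bounded[OF H F]) (rule that)
    define I where "I n = (\<integral>\<nu>. F \<nu> \<partial>filter_kernel X Y P Q H (zs n, as n))" for n
    define L where "L = (\<integral>\<nu>. F \<nu> \<partial>filter_kernel X Y P Q H (z, a))"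
    have sub: "\<exists>k. strict_mono k \<and> (\<lambda>n. I (r (k n))) \<longlonglongrightarrow> L" if r: "strict_mono r" for r :: "nat \<Rightarrow> nat"
    proof -
      have fr: "filterlim r sequentially sequentially" by (rule filterlim_subseq[OF r])
      obtain k C where k: "strict_mono k" and C: "C \<in> sets (borel_of (top_of_set Y))" "emeasure (?R (z, a)) C = 1"
        "\<And>y. y \<in> C \<Longrightarrow> converges_weakly (top_of_set X) (\<lambda>n. H (zs (r (k n)), as (r (k n)), y)) (H (z, a, y))"
        using Hsub[OF zs z converges_weakly_subseq[OF zlim fr] as a filterlim_compose[OF alim fr]] by auto
      have f: "filterlim (\<lambda>n. r (k n)) sequentially sequentially"
        by (rule filterlim_compose[OF fr filterlim_subseq[OF k]])
      have "limitin (belief_action X A) (\<lambda>n. (zs (r (k n)), as (r (k n)))) (z, a) sequentially"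
        by (rule limitin_belief_actionI[OF zs z converges_weakly_subseq[OF zlim f] as a filterlim_compose[OF alim f]])
      with Rc zs as have Rconv: "converges_setwise (top_of_set Y) (\<lambda>n. ?R (zs (r (k n)), as (r (k n)))) (?R (z, a))"
        unfolding setwise_continuous_def by simp
      interpret prob_space "?R (z, a)" using prob_measuresD(3)[OF R] .
      have CR: "C \<in> events" using C(1) by (simp add: prob_measuresD(1)[OF R])
      have "C \<subseteq> Y" using sets.sets_into_space[OF C(1)] by simp
      then have lim: "(\<lambda>n. F (H (zs (r (k n)), as (r (k n)), y))) \<longlonglongrightarrow> F (H (z, a, y))" if "y \<in> C" for y
        using that HP zs as z a
        by (intro bounded_continuous_converges_weakly[OF F _ _ C(3)]) auto
      have "AE y in ?R (z, a). y \<in> C" using C(2) by (intro AE_prob_1) (simp add: measure_def)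
      then have "AE y in ?R (z, a). (\<lambda>n. F (H (zs (r (k n)), as (r (k n)), y))) \<longlonglongrightarrow> F (H (z, a, y))"
        by (rule eventually_mono) (rule lim)
      then have "(\<lambda>n. I (r (k n))) \<longlonglongrightarrow> L"
        unfolding I_def L_def integral_filter_kernel[OF P Q H zs as Fm] integral_filter_kernel[OF P Q H z a Fm]
        by (intro setwise_convergence_integral[OF obs_kernel_prob_measures[OF P Q zs as] R Rconv
              filter_integrand_measurable[OF H F zs as] filter_integrand_measurable[OF H F z a], where M = M])
          (use M zs as z a in auto)
      with k show ?thesis by blast
    qed
    have "I \<longlonglongrightarrow> L"
    proof (rule ccontr)
      assume "\<not> I \<longlonglongrightarrow> L"
      then obtain e where e: "e > 0" "\<not> (\<forall>\<^sub>F n in sequentially. dist (I n) L < e)"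
        unfolding tendsto_iff by auto
      \<comment> \<open>Enumerating these indices gives a subsequence that stays at distance at
        least \<open>e\<close> from \<open>L\<close>, so none of its subsequences can converge to
        \<open>L\<close>.\<close>
      then have "infinite {n. \<not> dist (I n) L < e}"
        by (simp add: infinite_nat_iff_unbounded_le eventually_sequentially)
      from infinite_enumerate[OF this] obtain r :: "nat \<Rightarrow> nat" where
        r: "strict_mono r" "\<forall>n. \<not> dist (I (r n)) L < e"
        by (elim exE conjE) simp
      obtain k where "(\<lambda>n. I (r (k n))) \<longlonglongrightarrow> L" using sub[OF r(1)] by blast
      then have "\<forall>\<^sub>F n in sequentially. dist (I (r (k n))) L < e" using e(1) by (rule tendstoD)
      with r(2) show False by simp
    qed
    then show "(\<lambda>n. \<integral>\<nu>. F \<nu> \<partial>filter_kernel X Y P Q H (zs n, as n)) \<longlonglongrightarrow> (\<integral>\<nu>. F \<nu> \<partial>filter_kernel X Y P Q H (z, a))"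
      unfolding I_def L_def .
  qed
qed

end

theorem theorem3p5:
  fixes X :: "'x::polish_space set" and Y :: "'y::polish_space set" and A :: "'a::polish_space set"
    and P :: "'x \<times> 'a \<Rightarrow> 'x measure" and Q :: "'a \<times> 'x \<Rightarrow> 'y measure"
    and H :: "'x measure \<times> 'a \<times> 'y \<Rightarrow> 'x measure"
  assumes "X \<in> sets borel" and "Y \<in> sets borel" and "A \<in> sets borel"
    and "stochastic_kernel (top_of_set X) (prod_space X A) P"
    and "stochastic_kernel (top_of_set Y) (prod_space A X) Q"
    and "stochastic_kernel (top_of_set X) (belief_action_obs X A Y) H"
    and "filtering_equation X Y A P Q H"
    and "(setwise_continuous (top_of_set Y) (belief_action X A) (obs_kernel X Y P Q) \<and>
          assumption_H X Y A P Q) \<or>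
         (weakly_continuous (top_of_set X) (prod_space X A) P \<and>
          weakly_continuous (top_of_set Y) (prod_space A X) Q \<and>
          (\<exists>H'. stochastic_kernel (top_of_set X) (belief_action_obs X A Y) H' \<and>
                weakly_continuous (top_of_set X) (belief_action_obs X A Y) H' \<and>
                filtering_equation X Y A P Q H'))"
  shows "stochastic_kernel (weak_topology (top_of_set X)) (belief_action X A)
           (filter_kernel X Y P Q H) \<and>
         weakly_continuous (weak_topology (top_of_set X)) (belief_action X A)
           (filter_kernel X Y P Q H)"
proof
  note P = assms(4) and Q = assms(5) and H = assms(6,7)
  show "stochastic_kernel (weak_topology (top_of_set X)) (belief_action X A) (filter_kernel X Y P Q H)"
    by (rule stochastic_kernel_filter_kernel[OF P Q H(1)])
  have "\<exists>H'. stochastic_kernel (top_of_set X) (belief_action_obs X A Y) H' \<and> filtering_equation X Y A P Q H' \<and>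
      weakly_continuous (weak_topology (top_of_set X)) (belief_action X A) (filter_kernel X Y P Q H')"
    using assms(8)
  proof (elim disjE conjE exE)
    assume Rc: "setwise_continuous (top_of_set Y) (belief_action X A) (obs_kernel X Y P Q)"
      and "assumption_H X Y A P Q"
    from \<open>assumption_H X Y A P Q\<close> obtain H' where
      H': "stochastic_kernel (top_of_set X) (belief_action_obs X A Y) H'" "filtering_equation X Y A P Q H'"
      and sub: "\<forall>zs z as a.
        (\<forall>n. zs n \<in> prob_measures (top_of_set X)) \<and> z \<in> prob_measures (top_of_set X) \<and>
        converges_weakly (top_of_set X) zs z \<and> (\<forall>n. as n \<in> A) \<and> a \<in> A \<and> as \<longlonglongrightarrow> a \<longrightarrow>
        (\<exists>k C. strict_mono k \<and> C \<in> sets (borel_of (top_of_set Y)) \<and>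
          emeasure (obs_kernel X Y P Q (z, a)) C = 1 \<and>
          (\<forall>y \<in> C. converges_weakly (top_of_set X) (\<lambda>n. H' (zs (k n), as (k n), y)) (H' (z, a, y))))"
      unfolding assumption_H_def by (elim exE conjE)
    have "weakly_continuous (weak_topology (top_of_set X)) (belief_action X A) (filter_kernel X Y P Q H')"
      by (rule filter_kernel_weakly_continuous_of_setwise[OF P Q Rc H'(1)])
        (rule sub[rule_format], intro conjI allI, assumption+)
    with H' show ?thesis by blast
  next
    fix H'
    assume "weakly_continuous (top_of_set X) (prod_space X A) P"
      "weakly_continuous (top_of_set Y) (prod_space A X) Q"
      and H': "stochastic_kernel (top_of_set X) (belief_action_obs X A Y) H'"
        "weakly_continuous (top_of_set X) (belief_action_obs X A Y) H'" "filtering_equation X Y A P Q H'"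
    then have "weakly_continuous (weak_topology (top_of_set X)) (belief_action X A) (filter_kernel X Y P Q H')"
      by (intro filter_kernel_weakly_continuous[OF P Q])
    with H' show ?thesis by blast
  qed
  then obtain H' where H': "stochastic_kernel (top_of_set X) (belief_action_obs X A Y) H'" "filtering_equation X Y A P Q H'"
    "weakly_continuous (weak_topology (top_of_set X)) (belief_action X A) (filter_kernel X Y P Q H')"
    by (elim exE conjE)
  show "weakly_continuous (weak_topology (top_of_set X)) (belief_action X A) (filter_kernel X Y P Q H)"
    by (rule weakly_continuous_cong[OF H'(3) filter_kernel_unique[OF P Q H H'(1,2)]])
qed

end
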